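(* Consider the discretized two-material Poisson problem with piecewise linear ($p=1$) hat functions and two global linear enrichment functions, with all notation as fixed in the context, and let $x_k$ be an interior node of the mesh. Then the topological derivative for the enriched method at node $x_k$, $$d_T\bar G(x_k)=\lim_{\varepsilon\searrow 0}\frac{G(u^h_\varepsilon)-G(u^h)}{2\varepsilon},$$ is given by $$d_T\bar G(x_k)=S_0+S_1+S_2,$$ where $$S_0=\tfrac12\,\mathbf p^\top d\mathbf K^S\,\mathbf u,\qquad S_1=\big(\mathbf u^\top d\mathbf M^{SE}-(d\mathbf m^E)^\top\big)\mathbf u^E_0,\qquad S_2=\tfrac12\,\mathbf p^\top\big(d\mathbf K^S\mathbf H^\top-d\mathbf K^{SE}\big)\mathbf u^E_0,$$ $\mathbf u^E_0:=\lim_{\varepsilon\searrow0}\mathbf u^E_\varepsilon\in\mathbb R^2$, and the adjoint state $\mathbf p\in\mathbb R^{n_S}$ is the solution of $$(\mathbf K^S_0)^\top\mathbf p=-2(\mathbf M\mathbf u-\mathbf m).$$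
   Context: Setting. Let $\ell,\lambda_1,\lambda_2>0$, $D=(0,\ell)$, and let $f,\hat u\in L^2(D)$ be the given source term and desired state. Let $0=x_0<x_1<\dots<x_{n_S}<x_{n_S+1}=\ell$ be a mesh, and let $N^S_1,\dots,N^S_{n_S}$ be the continuous piecewise linear hat functions at the interior nodes, $N^S_i(x_j)=\delta_{ij}$, $N_i^S(0)=N_i^S(\ell)=0$. Fix an interior node $x_k$, $k\in\{1,\dots,n_S\}$, and let $\overline\varepsilon=\min(x_k-x_{k-1},x_{k+1}-x_k)$. Objective: $G(v)=\int_0^\ell (v(x)-\hat u(x))^2\,dx$. Topological perturbation: for $0<\varepsilon<\overline\varepsilon$ the diffusion coefficient is $\lambda_\varepsilon(x)=\lambda_2$ for $x\in(x_k-\varepsilon,x_k+\varepsilon)$ and $\lambda_\varepsilon(x)=\lambda_1$ for all other $x\in D$; for $\varepsilon=0$, $\lambda_0\equiv\lambda_1$. Enrichment functions: for $\kappa\in(0,\ell)$ let $N^E_{(\kappa)}(x)=x/\kappa$ for $x\le\kappa$ and $N^E_{(\kappa)}(x)=(\ell-x)/(\ell-\kappa)$ for $x>\kappa$. For $0\le\varepsilon<\overline\varepsilon$ set $N^E_{\varepsilon,1}=N^E_{(x_k-\varepsilon)}$, $N^E_{\varepsilon,2}=N^E_{(x_k+\varepsilon)}$ (so both equal $N^E_{(x_k)}$ at $\varepsilon=0$). Write $\mathbf N^S=[N_1^S,\dots,N^S_{n_S}]^\top$ and $\mathbf N^E_\varepsilon=[N^E_{\varepsilon,1},N^E_{\varepsilon,2}]^\top$.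 Matrices and vectors, for $0\le\varepsilon<\overline\varepsilon$ (prime denotes $d/dx$): $\mathbf K^S_\varepsilon=\int_0^\ell\lambda_\varepsilon(\mathbf N^S)'((\mathbf N^S)')^\top dx\in\mathbb R^{n_S\times n_S}$, $\mathbf K^{SE}_\varepsilon=\int_0^\ell\lambda_\varepsilon(\mathbf N^S)'((\mathbf N^E_\varepsilon)')^\top dx\in\mathbb R^{n_S\times2}$, $\mathbf K^{ES}_\varepsilon=(\mathbf K^{SE}_\varepsilon)^\top$, $\mathbf K^E_\varepsilon=\int_0^\ell\lambda_\varepsilon(\mathbf N^E_\varepsilon)'((\mathbf N^E_\varepsilon)')^\top dx\in\mathbb R^{2\times2}$, $\mathbf f^S=\int_0^\ell f\,\mathbf N^S dx$, $\mathbf f^E_\varepsilon=\int_0^\ell f\,\mathbf N^E_\varepsilon dx$, $\mathbf M=\int_0^\ell\mathbf N^S(\mathbf N^S)^\top dx$, $\mathbf m=\int_0^\ell\hat u\,\mathbf N^S dx$. The matrix $\mathbf H\in\mathbb R^{2\times n_S}$ has entries $\mathbf H[i,j]=N^E_{0,i}(x_j)$, so that $\mathbf N^E_0=\mathbf H\mathbf N^S$ on $D$. Unperturbed state: $u^h=(\mathbf N^S)^\top\mathbf u$ where $\mathbf u\in\mathbb R^{n_S}$ solves $\mathbf K^S_0\mathbf u=\mathbf f^S$. Perturbed state (enriched method), for $0<\varepsilon<\overline\varepsilon$: $u^h_\varepsilon=(\mathbf N^S)^\top\mathbf u^S_\varepsilon+(\mathbf N^E_\varepsilon)^\top\mathbf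 u^E_\varepsilon$, where $\mathbf u^S_\varepsilon\in\mathbb R^{n_S}$, $\mathbf u^E_\varepsilon\in\mathbb R^2$ solve $$\begin{bmatrix}\mathbf K^S_\varepsilon&\mathbf K^{SE}_\varepsilon\\ \mathbf K^{ES}_\varepsilon&\mathbf K^E_\varepsilon\end{bmatrix}\begin{bmatrix}\mathbf u^S_\varepsilon\\ \mathbf u^E_\varepsilon\end{bmatrix}=\begin{bmatrix}\mathbf f^S\\ \mathbf f^E_\varepsilon\end{bmatrix}.$$ One-sided derivatives: $d\mathbf K^S=\lim_{\varepsilon\searrow0}(\mathbf K^S_\varepsilon-\mathbf K^S_0)/\varepsilon$, $d\mathbf K^{SE}=\lim_{\varepsilon\searrow0}(\mathbf K^{SE}_\varepsilon-\mathbf K^{SE}_0)/\varepsilon$, and $d\mathbf M^{SE}=\int_0^\ell\mathbf N^S\big(\tfrac{d\mathbf N^E_\varepsilon}{d\varepsilon}\big|_{\varepsilon=0}\big)^\top dx\in\mathbb R^{n_S\times2}$, $d\mathbf m^E=\int_0^\ell\hat u\,\tfrac{d\mathbf N^E_\varepsilon}{d\varepsilon}\big|_{\varepsilon=0}dx\in\mathbb R^2$, where $\tfrac{d}{d\varepsilon}|_{\varepsilon=0}$ is the pointwise (a.e.) right derivative at $\varepsilon=0$.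
   Formalization: The sign of S_2 is corrected: the theorem proved has S_2 = ½ pᵀ(dK^SE − dK^S Hᵀ)u^E_0; with the printed bracket the claim fails, e.g. for ℓ=2, one node x_1=1, λ_1=λ_2=1, f=1, û=0, where the derivative is 1/6 but the printed sum is −1/6. *)

theory Defs
  imports "HOL-Analysis.Analysis" "Jordan_Normal_Form.Matrix"
begin

text \<open>
  The dimension of the finite element space is a natural number, so matrices and vectors are
  those of \<open>Jordan_Normal_Form.Matrix\<close>. They are indexed from 0, whereas the interior nodes
  are \<open>x 1, \<dots>, x n\<close>: the hat function at node \<open>x (Suc i)\<close> has index \<open>i\<close>. The domain
  \<open>D\<close> is \<open>{0<..<l}\<close> and carries Lebesgue measure.
\<close>

hide_type (open) Finite_Cartesian_Product.vec
unbundle no vec_syntax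
unbundle no inner_syntax

definition L2_on :: "real \<Rightarrow> (real \<Rightarrow> real) \<Rightarrow> bool" where
  "L2_on l f \<longleftrightarrow> f \<in> borel_measurable (lebesgue_on {0<..<l}) \<and>
     integrable (lebesgue_on {0<..<l}) (\<lambda>t. (f t)\<^sup>2)"

definition objective :: "real \<Rightarrow> (real \<Rightarrow> real) \<Rightarrow> (real \<Rightarrow> real) \<Rightarrow> real" where
  "objective l uhat v = (LINT t|lebesgue_on {0<..<l}. (v t - uhat t)\<^sup>2)"

definition hat :: "(nat \<Rightarrow> real) \<Rightarrow> nat \<Rightarrow> real \<Rightarrow> real" where
  "hat x i t =
     (if x (i - 1) \<le> t \<and> t \<le> x i then (t - x (i - 1)) / (x i - x (i - 1))
      else if x i < t \<and> t \<le> x (i + 1) then (x (i + 1) - t) / (x (i + 1) - x i)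
      else 0)"

definition NS :: "(nat \<Rightarrow> real) \<Rightarrow> nat \<Rightarrow> real \<Rightarrow> real" where
  "NS x i = hat x (Suc i)"

definition enrichment :: "real \<Rightarrow> real \<Rightarrow> real \<Rightarrow> real" where
  "enrichment l \<kappa> t = (if t \<le> \<kappa> then t / \<kappa> else (l - t) / (l - \<kappa>))"

definition NE :: "real \<Rightarrow> real \<Rightarrow> real \<Rightarrow> nat \<Rightarrow> real \<Rightarrow> real" where
  "NE l xk \<epsilon> i = (if i = 0 then enrichment l (xk - \<epsilon>) else enrichment l (xk + \<epsilon>))"

definition eps_bar :: "(nat \<Rightarrow> real) \<Rightarrow> nat \<Rightarrow> real" where
  "eps_bar x k = min (x k - x (k - 1)) (x (k + 1) - x k)"

text \<open>For \<open>\<epsilon> = 0\<close> the inclusion is empty, so the coefficient is constantly \<open>l1\<close>.\<close>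

definition diffusion :: "real \<Rightarrow> real \<Rightarrow> real \<Rightarrow> real \<Rightarrow> real \<Rightarrow> real" where
  "diffusion l1 l2 xk \<epsilon> t = (if t \<in> {xk - \<epsilon><..<xk + \<epsilon>} then l2 else l1)"

text \<open>
  The functions \<open>B i\<close> and \<open>C j\<close> are piecewise affine, and \<open>deriv\<close> is their classical derivative
  off the finitely many kinks; its value at the kinks does not affect the integral.
\<close>

definition stiffness ::
  "real \<Rightarrow> (real \<Rightarrow> real) \<Rightarrow> nat \<Rightarrow> (nat \<Rightarrow> real \<Rightarrow> real) \<Rightarrow> nat \<Rightarrow> (nat \<Rightarrow> real \<Rightarrow> real) \<Rightarrow> real mat" where
  "stiffness l lam r B c C = mat r c (\<lambda>(i, j).
     LINT t|lebesgue_on {0<..<l}. lam t * deriv (B i) t * deriv (C j) t)"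

definition mass ::
  "real \<Rightarrow> nat \<Rightarrow> (nat \<Rightarrow> real \<Rightarrow> real) \<Rightarrow> nat \<Rightarrow> (nat \<Rightarrow> real \<Rightarrow> real) \<Rightarrow> real mat" where
  "mass l r B c C = mat r c (\<lambda>(i, j). LINT t|lebesgue_on {0<..<l}. B i t * C j t)"

definition load :: "real \<Rightarrow> (real \<Rightarrow> real) \<Rightarrow> nat \<Rightarrow> (nat \<Rightarrow> real \<Rightarrow> real) \<Rightarrow> real vec" where
  "load l g r B = vec r (\<lambda>i. LINT t|lebesgue_on {0<..<l}. g t * B i t)"

definition KS :: "real \<Rightarrow> real \<Rightarrow> real \<Rightarrow> (nat \<Rightarrow> real) \<Rightarrow> nat \<Rightarrow> nat \<Rightarrow> real \<Rightarrow> real mat" where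
  "KS l l1 l2 x n k \<epsilon> = stiffness l (diffusion l1 l2 (x k) \<epsilon>) n (NS x) n (NS x)"

definition KSE :: "real \<Rightarrow> real \<Rightarrow> real \<Rightarrow> (nat \<Rightarrow> real) \<Rightarrow> nat \<Rightarrow> nat \<Rightarrow> real \<Rightarrow> real mat" where
  "KSE l l1 l2 x n k \<epsilon> = stiffness l (diffusion l1 l2 (x k) \<epsilon>) n (NS x) 2 (NE l (x k) \<epsilon>)"

definition KE :: "real \<Rightarrow> real \<Rightarrow> real \<Rightarrow> (nat \<Rightarrow> real) \<Rightarrow> nat \<Rightarrow> real \<Rightarrow> real mat" where
  "KE l l1 l2 x k \<epsilon> =
     stiffness l (diffusion l1 l2 (x k) \<epsilon>) 2 (NE l (x k) \<epsilon>) 2 (NE l (x k) \<epsilon>)"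

definition enriched_matrix ::
  "real \<Rightarrow> real \<Rightarrow> real \<Rightarrow> (nat \<Rightarrow> real) \<Rightarrow> nat \<Rightarrow> nat \<Rightarrow> real \<Rightarrow> real mat" where
  "enriched_matrix l l1 l2 x n k \<epsilon> = four_block_mat
     (KS l l1 l2 x n k \<epsilon>) (KSE l l1 l2 x n k \<epsilon>)
     (transpose_mat (KSE l l1 l2 x n k \<epsilon>)) (KE l l1 l2 x k \<epsilon>)"

definition fS :: "real \<Rightarrow> (real \<Rightarrow> real) \<Rightarrow> (nat \<Rightarrow> real) \<Rightarrow> nat \<Rightarrow> real vec" where
  "fS l f x n = load l f n (NS x)"

definition fE :: "real \<Rightarrow> (real \<Rightarrow> real) \<Rightarrow> (nat \<Rightarrow> real) \<Rightarrow> nat \<Rightarrow> real \<Rightarrow> real vec" where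
  "fE l f x k \<epsilon> = load l f 2 (NE l (x k) \<epsilon>)"

definition H_mat :: "real \<Rightarrow> (nat \<Rightarrow> real) \<Rightarrow> nat \<Rightarrow> nat \<Rightarrow> real mat" where
  "H_mat l x n k = mat 2 n (\<lambda>(i, j). NE l (x k) 0 i (x (Suc j)))"

definition fem_fun :: "nat \<Rightarrow> (nat \<Rightarrow> real \<Rightarrow> real) \<Rightarrow> real vec \<Rightarrow> real \<Rightarrow> real" where
  "fem_fun r B v t = (\<Sum>i<r. v $ i * B i t)"

definition uh :: "(nat \<Rightarrow> real) \<Rightarrow> nat \<Rightarrow> real vec \<Rightarrow> real \<Rightarrow> real" where
  "uh x n u = fem_fun n (NS x) u"

definition uh_enriched ::
  "real \<Rightarrow> (nat \<Rightarrow> real) \<Rightarrow> nat \<Rightarrow> nat \<Rightarrow> real \<Rightarrow> real vec \<Rightarrow> real vec \<Rightarrow> real \<Rightarrow> real" where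
  "uh_enriched l x n k \<epsilon> uS uE t = fem_fun n (NS x) uS t + fem_fun 2 (NE l (x k) \<epsilon>) uE t"

definition right_quotient :: "(real \<Rightarrow> real) \<Rightarrow> real \<Rightarrow> real" where
  "right_quotient g \<epsilon> = (g \<epsilon> - g 0) / \<epsilon>"

definition right_deriv :: "(real \<Rightarrow> real) \<Rightarrow> real" where
  "right_deriv g = Lim (at_right 0) (right_quotient g)"

definition right_differentiable :: "(real \<Rightarrow> real) \<Rightarrow> bool" where
  "right_differentiable g \<longleftrightarrow> (\<exists>d. (right_quotient g \<longlongrightarrow> d) (at_right 0))"

definition dKS :: "real \<Rightarrow> real \<Rightarrow> real \<Rightarrow> (nat \<Rightarrow> real) \<Rightarrow> nat \<Rightarrow> nat \<Rightarrow> real mat" where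
  "dKS l l1 l2 x n k = mat n n (\<lambda>ij. right_deriv (\<lambda>\<epsilon>. KS l l1 l2 x n k \<epsilon> $$ ij))"

definition dKSE :: "real \<Rightarrow> real \<Rightarrow> real \<Rightarrow> (nat \<Rightarrow> real) \<Rightarrow> nat \<Rightarrow> nat \<Rightarrow> real mat" where
  "dKSE l l1 l2 x n k = mat n 2 (\<lambda>ij. right_deriv (\<lambda>\<epsilon>. KSE l l1 l2 x n k \<epsilon> $$ ij))"

definition dNE :: "real \<Rightarrow> real \<Rightarrow> nat \<Rightarrow> real \<Rightarrow> real" where
  "dNE l xk i t = right_deriv (\<lambda>\<epsilon>. NE l xk \<epsilon> i t)"

definition dMSE :: "real \<Rightarrow> (nat \<Rightarrow> real) \<Rightarrow> nat \<Rightarrow> nat \<Rightarrow> real mat" where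
  "dMSE l x n k = mass l n (NS x) 2 (dNE l (x k))"

definition dmE :: "real \<Rightarrow> (real \<Rightarrow> real) \<Rightarrow> (nat \<Rightarrow> real) \<Rightarrow> nat \<Rightarrow> real vec" where
  "dmE l uhat x k = load l uhat 2 (dNE l (x k))"

definition S0 ::
  "real \<Rightarrow> real \<Rightarrow> real \<Rightarrow> (nat \<Rightarrow> real) \<Rightarrow> nat \<Rightarrow> nat \<Rightarrow> real vec \<Rightarrow> real vec \<Rightarrow> real" where
  "S0 l l1 l2 x n k u p = 1 / 2 * (p \<bullet> (dKS l l1 l2 x n k *\<^sub>v u))"

definition S1 ::
  "real \<Rightarrow> (real \<Rightarrow> real) \<Rightarrow> (nat \<Rightarrow> real) \<Rightarrow> nat \<Rightarrow> nat \<Rightarrow> real vec \<Rightarrow> real vec \<Rightarrow> real" where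
  "S1 l uhat x n k u uE0 = (transpose_mat (dMSE l x n k) *\<^sub>v u - dmE l uhat x k) \<bullet> uE0"

text \<open>
  Sign: the source prints the bracket as \<open>dK\<^sup>S H\<^sup>T - dK\<^sup>S\<^sup>E\<close>. With the adjoint equation
  \<open>K\<^sub>0\<^sup>T p = -2 (M u - m)\<close> that sign is wrong. Writing \<open>u\<^sup>S\<close>, \<open>u\<^sup>E\<close> for the enriched
  coefficients, subtracting \<open>K\<^sub>0 u = f\<^sup>S\<close> from the first block row, using
  \<open>K\<^sub>0\<^sup>S\<^sup>E = K\<^sub>0 H\<^sup>T\<close> and dividing by \<open>\<epsilon>\<close>, one gets in the limit
  \<open>K\<^sub>0 w = - dK\<^sup>S (u - H\<^sup>T u\<^sub>0\<^sup>E) - dK\<^sup>S\<^sup>E u\<^sub>0\<^sup>E\<close>, where \<open>w\<close> is the limit of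
  \<open>(u\<^sup>S + H\<^sup>T u\<^sup>E - u) / \<epsilon>\<close>. Hence
  \<open>(M u - m) \<bullet> w = 1/2 p \<bullet> (dK\<^sup>S u + (dK\<^sup>S\<^sup>E - dK\<^sup>S H\<^sup>T) u\<^sub>0\<^sup>E)\<close>.
  Counterexample to the printed sign: \<open>l = 2\<close>, \<open>n = k = 1\<close>, \<open>x 1 = 1\<close>, \<open>l1 = l2 = 1\<close>,
  \<open>f = 1\<close>, \<open>uhat = 0\<close>; the topological derivative is \<open>1/6\<close>, the printed sum is \<open>-1/6\<close>.
\<close>

definition S2 ::
  "real \<Rightarrow> real \<Rightarrow> real \<Rightarrow> (nat \<Rightarrow> real) \<Rightarrow> nat \<Rightarrow> nat \<Rightarrow> real vec \<Rightarrow> real vec \<Rightarrow> real" where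
  "S2 l l1 l2 x n k p uE0 = 1 / 2 * (p \<bullet>
     ((dKSE l l1 l2 x n k - dKS l l1 l2 x n k * transpose_mat (H_mat l x n k)) *\<^sub>v uE0))"

end

theory Submission
  imports Defs
begin

text \<open>
  Write \<open>E\<^sub>\<kappa>\<close> for the enrichment with kink \<open>\<kappa>\<close>, so that \<open>\<integral> v' E\<^sub>\<kappa>' = v(\<kappa>) l / (\<kappa> (l - \<kappa>))\<close> whenever \<open>v\<close>
  vanishes at the boundary; in particular the nodal values of the functions \<open>E\<close> at the mesh nodes
  give an explicit inverse of the unperturbed stiffness matrix. The enriched system degenerates at
  \<open>\<epsilon> = 0\<close> because \<open>E\<close> at the node lies in the span of the hat functions. Passing to
  \<open>w = u\<^sup>S + H\<^sup>T u\<^sup>E\<close>, subtracting \<open>H\<close> times the first block row from the second and dividing the result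
  by \<open>\<epsilon>\<close> yields a system with a block triangular limit, whose lower diagonal block is a positive multiple
  of the identity. Hence \<open>w\<close> and \<open>u\<^sup>E\<close> converge, and the first block row then determines the limit of
  \<open>K\<^sub>0 (w - u) / \<epsilon>\<close>, which is all that the adjoint state sees. The remaining part of the derivative of the objective
  comes from the difference quotients of the enrichments, by dominated convergence.
\<close>

section \<open>Energies of piecewise differentiable functions\<close>

text \<open>Why dividing by \<open>e\<close> is the right scaling: the slope of
  \<open>NE l c e 0 - enrichment l c\<close> is close to \<open>- J\<close> on
  \<open>{c - e<..<c}\<close>, that of \<open>NE l c e 1 - enrichment l c\<close> is close to
  \<open>J\<close> on \<open>{c<..<c + e}\<close>, where \<open>J = 1 / c + 1 / (l - c)\<close>, and
  both slopes are O(e) elsewhere. These two halves of the inclusion are disjoint, have length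
  \<open>e\<close> and carry the material \<open>l2\<close>. So the energies of the differences are
  \<open>l2 * J\<^sup>2 * e\<close> up to O(e^2) on the diagonal and O(e^2) off it, which explains
  the multiple of the identity. The obstacle is that the enriched matrix tends to a singular one, so
  its coefficients come without an a priori bound. Boundedness and convergence are obtained together
  by an absorption argument, and the limits so found are what allows the first block row to be
  divided by \<open>e\<close>.\<close>

lemma has_bochner_integral_piecewise_derivative:
  fixes G h :: "real \<Rightarrow> real"
  assumes ab: "a \<le> b" and S: "finite S" and cont: "continuous_on {a..b} G"
    and deriv: "\<And>t. t \<in> {a<..<b} - S \<Longrightarrow> (G has_real_derivative h t) (at t)"
    and bound: "\<And>t. t \<in> {a<..<b} - S \<Longrightarrow> \<bar>h t\<bar> \<le> C"
  shows "has_bochner_integral (lebesgue_on {a<..<b}) h (G b - G a)"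
proof -
  have hk: "(h has_integral (G b - G a)) {a..b}"
    by (rule fundamental_theorem_of_calculus_interior_strong[OF S ab _ cont])
      (simp add: deriv has_real_derivative_iff_has_vector_derivative[symmetric])
  then have hk': "(h has_integral (G b - G a)) {a<..<b}"
    using has_integral_open_interval[of h "G b - G a" a b] by simp
  \<comment> \<open>The bound \<open>C\<close> says nothing about the exceptional points, but the
    majorant must hold on the whole interval; the finitely many values there are put into the
    constant.\<close>
  define D where "D = Max (insert C ((\<lambda>t. \<bar>h t\<bar>) ` S))"
  have D: "\<bar>h t\<bar> \<le> D" if "t \<in> {a<..<b}" for t
  proof (cases "t \<in> S")
    case True
    then show ?thesis unfolding D_def using S by (intro Max_ge) auto
  next
    case False
    then have "\<bar>h t\<bar> \<le> C" using bound that by simp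
    also have "C \<le> D" unfolding D_def using S by (intro Max_ge) auto
    finally show ?thesis .
  qed
  have "(\<lambda>t. D) integrable_on {a<..<b}"
    using integrable_const_ivl[of D a b] integrable_on_open_interval[of "\<lambda>t. D" a b] by simp
  then have ai: "h absolutely_integrable_on {a<..<b}"
    using hk' D by (intro absolutely_integrable_integrable_bound[where g="\<lambda>t. D"]) (auto simp: has_integral_iff)
  then have i: "integrable (lebesgue_on {a<..<b}) h"
    by (simp add: integrable_restrict_space set_integrable_def)
  have "integral\<^sup>L (lebesgue_on {a<..<b}) h = G b - G a"
    using lebesgue_integral_eq_integral[OF i] hk' by (simp add: has_integral_iff)
  with i show ?thesis by (simp add: has_bochner_integral_iff)
qed

text \<open>A common class for hats and enrichments: continuity lets the fundamental theorem pass
  over the kinks, and the bound on the derivative gives integrability.\<close>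

definition piecewise_diff :: "real \<Rightarrow> (real \<Rightarrow> real) \<Rightarrow> bool" where
  "piecewise_diff l v \<longleftrightarrow> continuous_on {0..l} v \<and> (\<exists>S C. finite S \<and>
     (\<forall>t\<in>{0<..<l} - S. v differentiable (at t) \<and> \<bar>deriv v t\<bar> \<le> C))"

lemma piecewise_diffE:
  assumes "piecewise_diff l v"
  obtains S C where "finite S" "continuous_on {0..l} v" "0 \<le> C"
    "\<And>t. t \<in> {0<..<l} - S \<Longrightarrow> (v has_real_derivative deriv v t) (at t)"
    "\<And>t. t \<in> {0<..<l} - S \<Longrightarrow> \<bar>deriv v t\<bar> \<le> C"
proof -
  obtain S C where "finite S" "continuous_on {0..l} v"
    "\<And>t. t \<in> {0<..<l} - S \<Longrightarrow> v differentiable (at t)"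
    "\<And>t. t \<in> {0<..<l} - S \<Longrightarrow> \<bar>deriv v t\<bar> \<le> C"
    using assms unfolding piecewise_diff_def by blast
  moreover from this have "(v has_real_derivative deriv v t) (at t)" if "t \<in> {0<..<l} - S" for t
    using that DERIV_deriv_iff_real_differentiable by blast
  ultimately show ?thesis
    using that[of S "max 0 C"] by (meson max.coboundedI2 max.cobounded1)
qed

lemma AE_lebesgue_on_finite:
  assumes "finite S" "\<And>t. t \<in> {a<..<b} - S \<Longrightarrow> P t"
  shows "AE t in lebesgue_on {a<..<b::real}. P t"
proof -
  have "S \<in> null_sets lebesgue"
    using assms(1) by (simp add: negligible_finite negligible_iff_null_sets[symmetric])
  then have "AE t in lebesgue. t \<notin> S"
    by (rule AE_not_in)
  then show ?thesis
    using assms(2) by (subst AE_restrict_space_iff) auto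
qed

lemma integrable_lebesgue_on_bounded:
  fixes g :: "real \<Rightarrow> real"
  assumes "g \<in> borel_measurable (lebesgue_on {a<..<b})" "finite S"
    and "\<And>t. t \<in> {a<..<b} - S \<Longrightarrow> \<bar>g t\<bar> \<le> C"
  shows "integrable (lebesgue_on {a<..<b}) g"
proof -
  have "finite_measure (lebesgue_on {a<..<b})"
    using bounded_set_imp_lmeasurable[of "{a<..<b}"] by (intro finite_measure_lebesgue_on) auto
  then show ?thesis
    using assms AE_lebesgue_on_finite[OF assms(2), of a b "\<lambda>t. norm (g t) \<le> C"]
    by (intro finite_measure.integrable_const_bound[where B=C]) auto
qed

lemma borel_measurable_deriv:
  assumes "piecewise_diff l v" "0 \<le> l"
  shows "deriv v \<in> borel_measurable (lebesgue_on {0<..<l})"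
  using assms(1)
proof (rule piecewise_diffE)
  fix S C
  assume "finite S" "continuous_on {0..l} v"
    "\<And>t. t \<in> {0<..<l} - S \<Longrightarrow> (v has_real_derivative deriv v t) (at t)"
    "\<And>t. t \<in> {0<..<l} - S \<Longrightarrow> \<bar>deriv v t\<bar> \<le> C"
  then have "has_bochner_integral (lebesgue_on {0<..<l}) (deriv v) (v l - v 0)"
    using assms(2) by (intro has_bochner_integral_piecewise_derivative) auto
  then show ?thesis
    by (auto simp: has_bochner_integral_iff)
qed

lemma diffusion_measurable [measurable]: "diffusion l1 l2 c e \<in> borel_measurable borel"
  unfolding diffusion_def by measurable

lemma diffusion_bound: "\<bar>diffusion l1 l2 c e t\<bar> \<le> \<bar>l1\<bar> + \<bar>l2\<bar>"
  by (simp add: diffusion_def)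

lemma integrable_deriv_mult:
  assumes v: "piecewise_diff l v" and w: "piecewise_diff l w" and l: "0 \<le> l"
    and g: "g \<in> borel_measurable borel" "\<And>t. \<bar>g t\<bar> \<le> (D::real)"
  shows "integrable (lebesgue_on {0<..<l}) (\<lambda>t. g t * deriv v t * deriv w t)"
proof -
  obtain S C where S: "finite S" "0 \<le> C" "\<And>t. t \<in> {0<..<l} - S \<Longrightarrow> \<bar>deriv v t\<bar> \<le> C"
    using piecewise_diffE[OF v] by metis
  obtain T E where T: "finite T" "0 \<le> E" "\<And>t. t \<in> {0<..<l} - T \<Longrightarrow> \<bar>deriv w t\<bar> \<le> E"
    using piecewise_diffE[OF w] by metis
  have "g \<in> borel_measurable (lebesgue_on {0<..<l})"
    using g(1) by (intro measurable_restrict_space1 measurable_completion) simp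
  moreover have "\<bar>g t * deriv v t * deriv w t\<bar> \<le> D * C * E" if "t \<in> {0<..<l} - (S \<union> T)" for t
  proof -
    have "0 \<le> D" using g(2)[of t] by linarith
    then show ?thesis
      using that S T g(2) unfolding abs_mult by (intro mult_mono mult_nonneg_nonneg) auto
  qed
  ultimately show ?thesis
    using borel_measurable_deriv[OF v l] borel_measurable_deriv[OF w l] S(1) T(1)
    by (intro integrable_lebesgue_on_bounded[where S="S \<union> T"] borel_measurable_times) auto
qed

definition energy :: "real \<Rightarrow> (real \<Rightarrow> real) \<Rightarrow> (real \<Rightarrow> real) \<Rightarrow> (real \<Rightarrow> real) \<Rightarrow> real" where
  "energy l a v w = (LINT t|lebesgue_on {0<..<l}. a t * deriv v t * deriv w t)"

lemma energy_commute: "energy l a v w = energy l a w v"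
  by (simp add: energy_def mult.assoc mult.commute[of "deriv v _"])

text \<open>The coefficient departs from \<open>l1\<close> only on the inclusion, where both slopes
  are constant on each half; that part integrates to \<open>e\<close> times a sum of products of
  slopes.\<close>

lemma energy_diffusion:
  assumes v: "piecewise_diff l v" and w: "piecewise_diff l w"
    and e: "0 \<le> e" "0 < c - e" "c + e < l"
    and v1: "\<And>t. t \<in> {c-e<..<c} \<Longrightarrow> deriv v t = p1" and v2: "\<And>t. t \<in> {c<..<c+e} \<Longrightarrow> deriv v t = p2"
    and w1: "\<And>t. t \<in> {c-e<..<c} \<Longrightarrow> deriv w t = q1" and w2: "\<And>t. t \<in> {c<..<c+e} \<Longrightarrow> deriv w t = q2"
  shows "energy l (diffusion l1 l2 c e) v w
    = l1 * energy l (\<lambda>t. 1) v w + (l2 - l1) * (e * (p1 * q1 + p2 * q2))"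
proof -
  have l: "0 \<le> l" using e by linarith
  define h where "h t = (if t \<in> {c-e<..<c+e} then deriv v t * deriv w t else 0)" for t
  \<comment> \<open>The two terms clamp \<open>t\<close> to the left and to the right half of the
    inclusion. This makes \<open>G\<close> a continuous antiderivative of \<open>h\<close>, and each
    clamp grows by exactly \<open>e\<close> across the domain.\<close>
  define G where "G t = p1 * q1 * min c (max (c - e) t) + p2 * q2 * max c (min (c + e) t)" for t
  have G: "(G has_real_derivative h t) (at t) \<and> \<bar>h t\<bar> \<le> \<bar>p1 * q1\<bar> + \<bar>p2 * q2\<bar>"
    if "t \<in> {0<..<l} - {c - e, c, c + e}" for t
  proof -
    have "t \<noteq> c - e" "t \<noteq> c" "t \<noteq> c + e"
      using that by auto
    then have "t < c - e \<or> (c - e < t \<and> t < c) \<or> (c < t \<and> t < c + e) \<or> c + e < t"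
      by linarith
    then consider "t < c - e" | "t \<in> {c-e<..<c}" | "t \<in> {c<..<c+e}" | "t > c + e"
      by auto
    then show ?thesis
    proof cases
      case 1
      have "(G has_real_derivative 0) (at t)"
        by (rule has_field_derivative_transform_within_open[of "\<lambda>t. p1 * q1 * (c - e) + p2 * q2 * c" _ _ "{..<c-e}"])
          (use 1 e in \<open>auto simp: G_def\<close>)
      with 1 show ?thesis by (simp add: h_def)
    next
      case 2
      have "(G has_real_derivative p1 * q1) (at t)"
        by (rule has_field_derivative_transform_within_open[of "\<lambda>t. p1 * q1 * t + p2 * q2 * c" _ _ "{c-e<..<c}"])
          (use 2 e in \<open>auto simp: G_def intro!: derivative_eq_intros\<close>)
      with 2 show ?thesis by (simp add: h_def v1 w1)
    next
      case 3
      have "(G has_real_derivative p2 * q2) (at t)"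
        by (rule has_field_derivative_transform_within_open[of "\<lambda>t. p1 * q1 * c + p2 * q2 * t" _ _ "{c<..<c+e}"])
          (use 3 e in \<open>auto simp: G_def intro!: derivative_eq_intros\<close>)
      with 3 show ?thesis by (simp add: h_def v2 w2)
    next
      case 4
      have "(G has_real_derivative 0) (at t)"
        by (rule has_field_derivative_transform_within_open[of "\<lambda>t. p1 * q1 * c + p2 * q2 * (c + e)" _ _ "{c+e<..}"])
          (use 4 e in \<open>auto simp: G_def\<close>)
      with 4 show ?thesis by (simp add: h_def)
    qed
  qed
  have "continuous_on {0..l} G"
    unfolding G_def by (intro continuous_intros)
  then have "has_bochner_integral (lebesgue_on {0<..<l}) h (G l - G 0)"
    using G l by (intro has_bochner_integral_piecewise_derivative[where S="{c - e, c, c + e}" and C="\<bar>p1 * q1\<bar> + \<bar>p2 * q2\<bar>"]) auto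
  moreover have "G l - G 0 = e * (p1 * q1 + p2 * q2)"
    using e by (simp add: G_def min_def max_def algebra_simps)
  ultimately have h: "has_bochner_integral (lebesgue_on {0<..<l}) h (e * (p1 * q1 + p2 * q2))"
    by simp
  have g: "integrable (lebesgue_on {0<..<l}) (\<lambda>t. 1 * deriv v t * deriv w t)"
    by (rule integrable_deriv_mult[OF v w l, where D=1]) auto
  have "diffusion l1 l2 c e t * deriv v t * deriv w t
      = l1 * (1 * deriv v t * deriv w t) + (l2 - l1) * h t" for t
    by (simp add: diffusion_def h_def algebra_simps)
  then show ?thesis
    unfolding energy_def using h g by (simp add: has_bochner_integral_iff)
qed

text \<open>Equality of functions on an open interval passes to the derivatives off finitely many
  kinks, so \<open>g\<close> may be given by a formula of its own. The intended \<open>g\<close> is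
  an enrichment with its kink at a node, expanded in hat functions.\<close>

lemma energy_sum:
  assumes I: "finite I" and v: "\<And>i. i \<in> I \<Longrightarrow> piecewise_diff l (v i)"
    and w: "piecewise_diff l w" and l: "0 \<le> l"
    and a: "a \<in> borel_measurable borel" "\<And>t. \<bar>a t\<bar> \<le> (D::real)"
    and eq: "\<And>t. t \<in> {0<..<l} \<Longrightarrow> (\<Sum>i\<in>I. c i * v i t) = g t" and g: "piecewise_diff l g"
  shows "(\<Sum>i\<in>I. c i * energy l a (v i) w) = energy l a g w"
proof -
  have "\<exists>S. finite S \<and> (\<forall>t\<in>{0<..<l} - S. (v i has_real_derivative deriv (v i) t) (at t))"
    if "i \<in> I" for i
    using piecewise_diffE[OF v[OF that]] by metis
  then obtain S where S: "\<And>i. i \<in> I \<Longrightarrow> finite (S i)"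
    "\<And>i t. i \<in> I \<Longrightarrow> t \<in> {0<..<l} - S i \<Longrightarrow> (v i has_real_derivative deriv (v i) t) (at t)"
    by metis
  have int: "integrable (lebesgue_on {0<..<l}) (\<lambda>t. c i * (a t * deriv (v i) t * deriv w t))" if "i \<in> I" for i
    by (intro integrable_mult_right integrable_deriv_mult[OF v[OF that] w l a])
  have "(\<Sum>i\<in>I. c i * energy l a (v i) w)
      = (LINT t|lebesgue_on {0<..<l}. (\<Sum>i\<in>I. c i * (a t * deriv (v i) t * deriv w t)))"
    unfolding energy_def using int by (subst Bochner_Integration.integral_sum) auto
  also have "\<dots> = energy l a g w"
    unfolding energy_def
  proof (rule integral_cong_AE)
    show "(\<lambda>t. \<Sum>i\<in>I. c i * (a t * deriv (v i) t * deriv w t)) \<in> borel_measurable (lebesgue_on {0<..<l})"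
      using int by (intro borel_measurable_sum borel_measurable_integrable)
    show "(\<lambda>t. a t * deriv g t * deriv w t) \<in> borel_measurable (lebesgue_on {0<..<l})"
      by (intro borel_measurable_integrable integrable_deriv_mult[OF g w l a])
    show "AE t in lebesgue_on {0<..<l}.
        (\<Sum>i\<in>I. c i * (a t * deriv (v i) t * deriv w t)) = a t * deriv g t * deriv w t"
    proof (rule AE_lebesgue_on_finite[where S="\<Union>i\<in>I. S i"])
      fix t assume t: "t \<in> {0<..<l} - (\<Union>i\<in>I. S i)"
      have "((\<lambda>t. \<Sum>i\<in>I. c i * v i t) has_real_derivative (\<Sum>i\<in>I. c i * deriv (v i) t)) (at t)"
        using t S(2) by (intro DERIV_sum DERIV_cmult) auto
      then have "(g has_real_derivative (\<Sum>i\<in>I. c i * deriv (v i) t)) (at t)"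
        by (rule has_field_derivative_transform_within_open[where S="{0<..<l}"]) (use t eq in auto)
      then have "deriv g t = (\<Sum>i\<in>I. c i * deriv (v i) t)"
        by (rule DERIV_imp_deriv)
      then show "(\<Sum>i\<in>I. c i * (a t * deriv (v i) t * deriv w t)) = a t * deriv g t * deriv w t"
        by (simp add: sum_distrib_left sum_distrib_right mult_ac)
    qed (use I S(1) in auto)
  qed
  finally show ?thesis .
qed

section \<open>Enrichment functions\<close>

text \<open>In the form of a minimum, continuity across the kink and the Lipschitz estimate in the
  position of the kink follow without comparing \<open>t\<close> with the kink.\<close>

lemma enrichment_eq_min:
  assumes "0 < \<kappa>" "\<kappa> < l"
  shows "enrichment l \<kappa> t = min (t / \<kappa>) ((l - t) / (l - \<kappa>))"
proof (cases "t \<le> \<kappa>")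
  case True
  then have "t / \<kappa> \<le> 1" "1 \<le> (l - t) / (l - \<kappa>)"
    using assms by (auto simp: field_simps)
  then show ?thesis using True by (simp add: enrichment_def)
next
  case False
  then have "1 \<le> t / \<kappa>" "(l - t) / (l - \<kappa>) \<le> 1"
    using assms by (auto simp: field_simps)
  then show ?thesis using False by (simp add: enrichment_def)
qed

lemma continuous_on_enrichment:
  assumes "0 < \<kappa>" "\<kappa> < l"
  shows "continuous_on A (enrichment l \<kappa>)"
proof -
  have "enrichment l \<kappa> = (\<lambda>t. min (t / \<kappa>) ((l - t) / (l - \<kappa>)))"
    using enrichment_eq_min[OF assms] by blast
  then show ?thesis using assms by (auto intro!: continuous_intros)
qed

lemma enrichment_right: "\<kappa> \<noteq> l \<Longrightarrow> 0 < \<kappa> \<Longrightarrow> \<kappa> \<le> t \<Longrightarrow> enrichment l \<kappa> t = (l - t) / (l - \<kappa>)"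
  by (auto simp: enrichment_def)

lemma enrichment_has_real_derivative:
  assumes "0 < \<kappa>" "\<kappa> < l" "t \<noteq> \<kappa>"
  shows "(enrichment l \<kappa> has_real_derivative (if t < \<kappa> then 1 / \<kappa> else - 1 / (l - \<kappa>))) (at t)"
proof (cases "t < \<kappa>")
  case True
  have "((\<lambda>t. t / \<kappa>) has_real_derivative 1 / \<kappa>) (at t)"
    using assms by (auto intro!: derivative_eq_intros)
  then have "(enrichment l \<kappa> has_real_derivative 1 / \<kappa>) (at t)"
    by (rule has_field_derivative_transform_within_open[where S="{..<\<kappa>}"])
      (use True in \<open>auto simp: enrichment_def\<close>)
  with True show ?thesis by simp
next
  case False
  have "((\<lambda>t. (l - t) / (l - \<kappa>)) has_real_derivative - 1 / (l - \<kappa>)) (at t)"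
    using assms by (auto intro!: derivative_eq_intros simp: divide_simps)
  then have "(enrichment l \<kappa> has_real_derivative - 1 / (l - \<kappa>)) (at t)"
    by (rule has_field_derivative_transform_within_open[where S="{\<kappa><..}"])
      (use False assms(3) in \<open>auto simp: enrichment_def\<close>)
  with False show ?thesis by simp
qed

lemma deriv_enrichment:
  assumes "0 < \<kappa>" "\<kappa> < l"
  shows "t < \<kappa> \<Longrightarrow> deriv (enrichment l \<kappa>) t = 1 / \<kappa>"
    and "\<kappa> < t \<Longrightarrow> deriv (enrichment l \<kappa>) t = - 1 / (l - \<kappa>)"
  using DERIV_imp_deriv[OF enrichment_has_real_derivative[OF assms]] by auto

lemma piecewise_diff_enrichment:
  assumes "0 < \<kappa>" "\<kappa> < l"
  shows "piecewise_diff l (enrichment l \<kappa>)"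
  unfolding piecewise_diff_def
proof (intro conjI exI ballI)
  show "continuous_on {0..l} (enrichment l \<kappa>)"
    by (rule continuous_on_enrichment[OF assms])
  show "finite {\<kappa>}" by simp
  fix t assume t: "t \<in> {0<..<l} - {\<kappa>}"
  then show "enrichment l \<kappa> differentiable at t"
    using enrichment_has_real_derivative[OF assms, of t] real_differentiable_def by blast
  show "\<bar>deriv (enrichment l \<kappa>) t\<bar> \<le> 1 / \<kappa> + 1 / (l - \<kappa>)"
    using t assms by (cases "t < \<kappa>") (auto simp: deriv_enrichment)
qed

text \<open>The slope of the enrichment is constant on either side of its kink, so the integral
  telescopes to \<open>v \<kappa> / \<kappa> + v \<kappa> / (l - \<kappa>)\<close>. Up to
  normalisation this is the reproducing property of the Green's function of the Dirichlet problem
  with pole \<open>\<kappa>\<close>.\<close>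

lemma energy_enrichment:
  assumes v: "piecewise_diff l v" and v0: "v 0 = 0" "v l = 0" and \<kappa>: "0 < \<kappa>" "\<kappa> < l"
  shows "energy l (\<lambda>t. 1) v (enrichment l \<kappa>) = v \<kappa> * (l / (\<kappa> * (l - \<kappa>)))"
proof -
  let ?h = "\<lambda>t. 1 * deriv v t * deriv (enrichment l \<kappa>) t"
  \<comment> \<open>The first term is frozen to the right of the kink and the second to the left of
    it, which glues the antiderivatives of the two sides continuously.\<close>
  define G where "G t = v (min t \<kappa>) / \<kappa> - (v (max t \<kappa>) - v \<kappa>) / (l - \<kappa>)" for t
  obtain S C where S: "finite S" "0 \<le> C" and cont: "continuous_on {0..l} v"
    and d: "\<And>t. t \<in> {0<..<l} - S \<Longrightarrow> (v has_real_derivative deriv v t) (at t)"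
    and C: "\<And>t. t \<in> {0<..<l} - S \<Longrightarrow> \<bar>deriv v t\<bar> \<le> C"
    using piecewise_diffE[OF v] by metis
  have c1: "continuous_on {0..l} (\<lambda>t. v (min t \<kappa>))" and c2: "continuous_on {0..l} (\<lambda>t. v (max t \<kappa>))"
    by (rule continuous_on_compose2[OF cont]; use \<kappa> in \<open>auto intro!: continuous_intros\<close>)+
  have "continuous_on {0..l} G"
    unfolding G_def using \<kappa> by (intro continuous_intros c1 c2) auto
  then have "has_bochner_integral (lebesgue_on {0<..<l}) ?h (G l - G 0)"
  proof (rule has_bochner_integral_piecewise_derivative[rotated 2, where S="insert \<kappa> S"
        and C="C * (1 / \<kappa> + 1 / (l - \<kappa>))"])
    fix t assume t: "t \<in> {0<..<l} - insert \<kappa> S"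
    have "\<bar>deriv (enrichment l \<kappa>) t\<bar> \<le> 1 / \<kappa> + 1 / (l - \<kappa>)"
      using t \<kappa> by (cases "t < \<kappa>") (auto simp: deriv_enrichment)
    then show "\<bar>1 * deriv v t * deriv (enrichment l \<kappa>) t\<bar> \<le> C * (1 / \<kappa> + 1 / (l - \<kappa>))"
      using C[of t] S t unfolding abs_mult by (intro mult_mono) auto
    show "(G has_real_derivative ?h t) (at t)"
    proof (cases "t < \<kappa>")
      case True
      have "((\<lambda>t. v t / \<kappa> - (v \<kappa> - v \<kappa>) / (l - \<kappa>)) has_real_derivative deriv v t / \<kappa>) (at t)"
        using d[of t] t \<kappa> by (auto intro!: derivative_eq_intros)
      then have "(G has_real_derivative deriv v t / \<kappa>) (at t)"
        by (rule has_field_derivative_transform_within_open[where S="{..<\<kappa>}"])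
          (use True in \<open>auto simp: G_def\<close>)
      then show ?thesis using True \<kappa> by (simp add: deriv_enrichment)
    next
      case False
      have "((\<lambda>t. v \<kappa> / \<kappa> - (v t - v \<kappa>) / (l - \<kappa>)) has_real_derivative - deriv v t / (l - \<kappa>)) (at t)"
        using d[of t] t \<kappa> by (auto intro!: derivative_eq_intros)
      then have "(G has_real_derivative - deriv v t / (l - \<kappa>)) (at t)"
        by (rule has_field_derivative_transform_within_open[where S="{\<kappa><..}"])
          (use False t in \<open>auto simp: G_def\<close>)
      then show ?thesis using False t \<kappa> by (simp add: deriv_enrichment)
    qed
  qed (use \<kappa> S in auto)
  moreover have "G l - G 0 = v \<kappa> / \<kappa> + v \<kappa> / (l - \<kappa>)"
    using \<kappa> v0 by (simp add: G_def)
  moreover have "\<dots> = v \<kappa> * (l / (\<kappa> * (l - \<kappa>)))"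
    using \<kappa> by (simp add: field_simps)
  ultimately show ?thesis
    by (simp add: energy_def has_bochner_integral_iff)
qed

text \<open>The conditions on \<open>\<kappa>\<close> keep both denominators at least half as large
  as they are at \<open>c\<close>, whence the factor 2. The constant depends on neither
  \<open>t\<close> nor \<open>\<kappa>\<close> and will dominate the difference quotients.\<close>

lemma enrichment_lipschitz:
  assumes "0 < c" "c < l" "\<kappa> \<ge> c / 2" "l - \<kappa> \<ge> (l - c) / 2" "0 \<le> t" "t \<le> l"
  shows "\<bar>enrichment l \<kappa> t - enrichment l c t\<bar> \<le> (2 * l / c\<^sup>2 + 2 * l / (l - c)\<^sup>2) * \<bar>\<kappa> - c\<bar>"
proof -
  have quotient: "\<bar>s / a - s / b\<bar> \<le> 2 * l / b\<^sup>2 * \<bar>a - b\<bar>"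
    if "0 < b" "b / 2 \<le> a" "0 \<le> s" "s \<le> l" for s a b :: real
  proof -
    have a: "0 < a" using that by linarith
    have "\<bar>s / a - s / b\<bar> = s / (a * b) * \<bar>a - b\<bar>"
    proof -
      have "s / a - s / b = s / (a * b) * (b - a)"
        using a that(1) by (simp add: field_simps)
      then show ?thesis
        using a that by (simp add: abs_mult abs_minus_commute)
    qed
    also have "\<dots> \<le> 2 * l / b\<^sup>2 * \<bar>a - b\<bar>"
    proof (rule mult_right_mono)
      have "s / (a * b) \<le> l / (b / 2 * b)"
        using that a by (intro frac_le mult_right_mono mult_pos_pos) auto
      also have "\<dots> = 2 * l / b\<^sup>2" by (simp add: power2_eq_square)
      finally show "s / (a * b) \<le> 2 * l / b\<^sup>2" .
    qed simp
    finally show ?thesis .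
  qed
  have 1: "\<bar>t / \<kappa> - t / c\<bar> \<le> 2 * l / c\<^sup>2 * \<bar>\<kappa> - c\<bar>"
    using assms by (intro quotient) auto
  have 2: "\<bar>(l - t) / (l - \<kappa>) - (l - t) / (l - c)\<bar> \<le> 2 * l / (l - c)\<^sup>2 * \<bar>(l - \<kappa>) - (l - c)\<bar>"
    using assms by (intro quotient) auto
  have "\<bar>min a b - min a' b'\<bar> \<le> \<bar>a - a'\<bar> + \<bar>b - b'\<bar>" for a b a' b' :: real
    by linarith
  then have "\<bar>enrichment l \<kappa> t - enrichment l c t\<bar>
      \<le> \<bar>t / \<kappa> - t / c\<bar> + \<bar>(l - t) / (l - \<kappa>) - (l - t) / (l - c)\<bar>"
    using assms by (simp add: enrichment_eq_min)
  also have "\<dots> \<le> 2 * l / c\<^sup>2 * \<bar>\<kappa> - c\<bar> + 2 * l / (l - c)\<^sup>2 * \<bar>\<kappa> - c\<bar>"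
    using 1 2 by (simp add: abs_minus_commute)
  finally show ?thesis by (simp add: distrib_right)
qed

section \<open>One-sided difference quotients of the enrichments and their integrals\<close>

lemma right_deriv_eqI: "(right_quotient g \<longlongrightarrow> d) (at_right 0) \<Longrightarrow> right_deriv g = d"
  unfolding right_deriv_def by (intro tendsto_Lim) auto

lemma tendsto_right_deriv:
  "right_differentiable g \<Longrightarrow> (right_quotient g \<longlongrightarrow> right_deriv g) (at_right 0)"
  using right_deriv_eqI unfolding right_differentiable_def by auto

text \<open>Explicit formulas are valid only for small nonnegative \<open>e\<close>; the smooth
  formula \<open>G\<close> stands in for \<open>g\<close> there and can be differentiated by the
  usual two-sided rules.\<close>

lemma right_quotient_tendsto:
  assumes G: "(G has_real_derivative d) (at 0)" and \<delta>: "0 < \<delta>"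
    and eq: "\<And>e. 0 \<le> e \<Longrightarrow> e < \<delta> \<Longrightarrow> g e = G e"
  shows "(right_quotient g \<longlongrightarrow> d) (at_right 0)"
proof -
  have "((\<lambda>e. (G e - G 0) / e) \<longlongrightarrow> d) (at_right 0)"
    using G unfolding has_field_derivative_iff by (auto intro: tendsto_within_subset)
  then show ?thesis
  proof (rule Lim_transform_eventually)
    show "\<forall>\<^sub>F e in at_right 0. (G e - G 0) / e = right_quotient g e"
      using eventually_at_right_less[of 0] eventually_at_right_real[OF \<delta>]
      by eventually_elim (use \<delta> in \<open>simp add: right_quotient_def eq\<close>)
  qed
qed

text \<open>A small shift of the kink does not pass a point \<open>t\<close> different from
  \<open>c\<close>, so one smooth branch is differentiated with respect to the kink. The sign
  records that the kink of index 0 moves to the left and the other one to the right.\<close>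

lemma right_quotient_NE_tendsto:
  assumes c: "0 < c" "c < l" and t: "t \<noteq> c"
  shows "(right_quotient (\<lambda>e. NE l c e i t) \<longlongrightarrow> (if i = 0 then - 1 else 1)
    * (if t < c then - t / c\<^sup>2 else (l - t) / (l - c)\<^sup>2)) (at_right 0)"
proof -
  define s :: real where "s = (if i = 0 then - 1 else 1)"
  have NE: "NE l c e i t = enrichment l (c + s * e) t" for e
    by (simp add: NE_def s_def)
  define \<delta> where "\<delta> = \<bar>t - c\<bar>"
  have \<delta>: "0 < \<delta>" using t by (simp add: \<delta>_def)
  have "(right_quotient (\<lambda>e. NE l c e i t) \<longlongrightarrow> s * (if t < c then - t / c\<^sup>2 else (l - t) / (l - c)\<^sup>2)) (at_right 0)"
  proof (cases "t < c")
    case True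
    have "((\<lambda>e. t / (c + s * e)) has_real_derivative s * (- t / c\<^sup>2)) (at 0)"
      using c by (auto intro!: derivative_eq_intros simp: power2_eq_square)
    then have "(right_quotient (\<lambda>e. NE l c e i t) \<longlongrightarrow> s * (- t / c\<^sup>2)) (at_right 0)"
      by (rule right_quotient_tendsto[OF _ \<delta>])
        (use True in \<open>auto simp: NE enrichment_def \<delta>_def s_def\<close>)
    with True show ?thesis by simp
  next
    case False
    have "((\<lambda>e. (l - t) / (l - (c + s * e))) has_real_derivative s * ((l - t) / (l - c)\<^sup>2)) (at 0)"
      using c by (auto intro!: derivative_eq_intros simp: power2_eq_square)
    then have "(right_quotient (\<lambda>e. NE l c e i t) \<longlongrightarrow> s * ((l - t) / (l - c)\<^sup>2)) (at_right 0)"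
      by (rule right_quotient_tendsto[OF _ \<delta>])
        (use False t in \<open>auto simp: NE enrichment_def \<delta>_def s_def\<close>)
    with False show ?thesis by simp
  qed
  then show ?thesis by (simp only: s_def)
qed

lemma right_differentiable_NE:
  "0 < c \<Longrightarrow> c < l \<Longrightarrow> t \<noteq> c \<Longrightarrow> right_differentiable (\<lambda>e. NE l c e i t)"
  unfolding right_differentiable_def using right_quotient_NE_tendsto by blast

lemma dNE_measurable:
  assumes c: "0 < c" "c < l"
  shows "dNE l c i \<in> borel_measurable (lebesgue_on A)"
proof -
  \<comment> \<open>The value at the kink is left uncomputed; as a single constant it does not
    disturb measurability.\<close>
  have "dNE l c i = (\<lambda>t. if t = c then dNE l c i c else (if i = 0 then - 1 else 1)
    * (if t < c then - t / c\<^sup>2 else (l - t) / (l - c)\<^sup>2))"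
    using right_deriv_eqI[OF right_quotient_NE_tendsto[OF c]] by (auto simp: dNE_def fun_eq_iff)
  also have "\<dots> \<in> borel_measurable lborel"
    by measurable
  finally show ?thesis
    by (intro measurable_restrict_space1 measurable_completion)
qed

lemma right_quotient_NE_bound:
  assumes c: "0 < c" "c < l" and e: "0 < e" "e \<le> c / 2" "e \<le> (l - c) / 2" and t: "0 \<le> t" "t \<le> l"
  shows "\<bar>right_quotient (\<lambda>e. NE l c e i t) e\<bar> \<le> 2 * l / c\<^sup>2 + 2 * l / (l - c)\<^sup>2"
proof -
  define s :: real where "s = (if i = 0 then - 1 else 1)"
  have "\<bar>enrichment l (c + s * e) t - enrichment l c t\<bar>
      \<le> (2 * l / c\<^sup>2 + 2 * l / (l - c)\<^sup>2) * \<bar>c + s * e - c\<bar>"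
    using e by (intro enrichment_lipschitz c t) (auto simp: s_def)
  moreover have "\<bar>c + s * e - c\<bar> = e"
    using e by (simp add: s_def)
  moreover have "NE l c e i t - NE l c 0 i t = enrichment l (c + s * e) t - enrichment l c t"
    by (simp add: NE_def s_def)
  ultimately show ?thesis
    using e by (simp add: right_quotient_def abs_divide divide_le_eq)
qed

lemma integrable_if_L2_on:
  assumes "L2_on l g"
  shows "integrable (lebesgue_on {0<..<l}) g"
proof (rule Bochner_Integration.integrable_bound)
  have "integrable (lebesgue_on {0<..<l}) (\<lambda>t. 1::real)"
    by (rule integrable_lebesgue_on_bounded[where C=1 and S="{}"]) auto
  then show "integrable (lebesgue_on {0<..<l}) (\<lambda>t. 1 + (g t)\<^sup>2)"
    using assms by (auto simp: L2_on_def)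
  show "g \<in> borel_measurable (lebesgue_on {0<..<l})"
    using assms by (simp add: L2_on_def)
  have "\<bar>y\<bar> \<le> 1 + y\<^sup>2" for y :: real
  proof -
    have "0 \<le> (\<bar>y\<bar> - 1)\<^sup>2" by simp
    then have "2 * \<bar>y\<bar> \<le> 1 + y\<^sup>2" by (simp add: power2_diff)
    then show ?thesis by linarith
  qed
  then show "AE t in lebesgue_on {0<..<l}. norm (g t) \<le> norm (1 + (g t)\<^sup>2)"
    by simp
qed

lemma measurable_lebesgue_on_continuous:
  "continuous_on {0..l} g \<Longrightarrow> (g::real\<Rightarrow>real) \<in> borel_measurable (lebesgue_on {0<..<l})"
  by (rule continuous_imp_measurable_on_sets_lebesgue) (auto elim: continuous_on_subset)

lemma right_quotient_NE_measurable:
  assumes c: "0 < c" "c < l" and e: "0 < e" "e < c" "e < l - c"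
  shows "(\<lambda>t. right_quotient (\<lambda>e. NE l c e i t) e) \<in> borel_measurable (lebesgue_on {0<..<l})"
proof (rule measurable_lebesgue_on_continuous)
  have "NE l c e i = enrichment l (if i = 0 then c - e else c + e)" "NE l c 0 i = enrichment l c"
    by (auto simp: NE_def fun_eq_iff)
  then have "continuous_on {0..l} (NE l c e i)" "continuous_on {0..l} (NE l c 0 i)"
    using e c by (auto intro!: continuous_on_enrichment)
  then show "continuous_on {0..l} (\<lambda>t. right_quotient (\<lambda>e. NE l c e i t) e)"
    unfolding right_quotient_def using e by (intro continuous_intros) auto
qed

text \<open>The quotients converge away from the point \<open>c\<close> and are bounded uniformly in
  \<open>e\<close> and \<open>t\<close>, so a multiple of the absolute value of \<open>g\<close>
  dominates. It serves with \<open>f\<close>, \<open>uhat\<close> and the hat functions in the role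
  of \<open>g\<close>.\<close>

lemma tendsto_LINT_right_quotient_NE:
  assumes c: "0 < c" "c < l" and g: "integrable (lebesgue_on {0<..<l}) g"
  shows "((\<lambda>e. LINT t|lebesgue_on {0<..<l}. g t * right_quotient (\<lambda>e. NE l c e i t) e)
     \<longlongrightarrow> (LINT t|lebesgue_on {0<..<l}. g t * dNE l c i t)) (at_right 0)"
proof -
  define \<delta> where "\<delta> = min (c / 2) ((l - c) / 2)"
  have \<delta>: "0 < \<delta>" using c by (simp add: \<delta>_def)
  define B where "B = 2 * l / c\<^sup>2 + 2 * l / (l - c)\<^sup>2"
  have lim: "((\<lambda>e. right_quotient (\<lambda>e. NE l c e i t) e) \<longlongrightarrow> dNE l c i t) (at_right 0)"
    if "t \<noteq> c" for t
    unfolding dNE_def using tendsto_right_deriv[OF right_differentiable_NE[OF c that]] by simp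
  \<comment> \<open>Dominated convergence is available for sequences, so the limit is taken within a
    right neighbourhood of 0 and tested along sequences. The radius \<open>\<delta>\<close> is the
    range of the uniform bound.\<close>
  have "((\<lambda>e. LINT t|lebesgue_on {0<..<l}. g t * right_quotient (\<lambda>e. NE l c e i t) e)
     \<longlongrightarrow> (LINT t|lebesgue_on {0<..<l}. g t * dNE l c i t)) (at 0 within {0<..<\<delta>})"
    unfolding tendsto_at_iff_sequentially o_def
  proof (intro allI impI)
    fix X assume X: "\<forall>i. X i \<in> {0<..<\<delta>} - {0}" and X0: "X \<longlonglongrightarrow> 0"
    have X': "filterlim X (at_right 0) sequentially"
      using X X0 by (auto simp: filterlim_at less_imp_neq[symmetric] intro!: always_eventually)
    have "AE t in lebesgue_on {0<..<l}. t \<noteq> c"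
      by (rule AE_lebesgue_on_finite[where S="{c}"]) auto
    then have ae: "AE t in lebesgue_on {0<..<l}.
        (\<lambda>n. g t * right_quotient (\<lambda>e. NE l c e i t) (X n)) \<longlonglongrightarrow> g t * dNE l c i t"
      by eventually_elim (intro tendsto_mult tendsto_const filterlim_compose[OF lim X'])
    have Xn: "0 < X n" "X n < c" "X n < l - c" for n
      using X[rule_format, of n] c by (auto simp: \<delta>_def min_less_iff_conj)
    have meas: "(\<lambda>t. g t * right_quotient (\<lambda>e. NE l c e i t) (X n)) \<in> borel_measurable (lebesgue_on {0<..<l})" for n
      using g by (intro borel_measurable_times right_quotient_NE_measurable c Xn) auto
    show "(\<lambda>n. LINT t|lebesgue_on {0<..<l}. g t * right_quotient (\<lambda>e. NE l c e i t) (X n))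
        \<longlonglongrightarrow> (LINT t|lebesgue_on {0<..<l}. g t * dNE l c i t)"
    proof (rule integral_dominated_convergence[OF _ meas _ ae, where w="\<lambda>t. \<bar>g t\<bar> * B"])
      show "(\<lambda>t. g t * dNE l c i t) \<in> borel_measurable (lebesgue_on {0<..<l})"
        using g dNE_measurable[OF c] by (intro borel_measurable_times) auto
      show "integrable (lebesgue_on {0<..<l}) (\<lambda>t. \<bar>g t\<bar> * B)"
        using g by simp
      show "AE t in lebesgue_on {0<..<l}. norm (g t * right_quotient (\<lambda>e. NE l c e i t) (X n)) \<le> \<bar>g t\<bar> * B" for n
      proof (rule AE_lebesgue_on_finite[where S="{}"])
        fix t assume "t \<in> {0<..<l} - {}"
        then have "\<bar>right_quotient (\<lambda>e. NE l c e i t) (X n)\<bar> \<le> B"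
          unfolding B_def using X[rule_format, of n] by (intro right_quotient_NE_bound c) (auto simp: \<delta>_def)
        then show "norm (g t * right_quotient (\<lambda>e. NE l c e i t) (X n)) \<le> \<bar>g t\<bar> * B"
          by (simp add: abs_mult mult_left_mono)
      qed simp
    qed
  qed
  then show ?thesis
    using at_within_nhd[of 0 "{..<\<delta>}" "{0<..<\<delta>}" "{0<..}"] \<delta> by (auto simp: Int_def)
qed

section \<open>Hat functions\<close>

locale mesh =
  fixes l :: real and x :: "nat \<Rightarrow> real" and n :: nat
  assumes x_0: "x 0 = 0" and x_end: "x (Suc n) = l"
    and x_step: "\<And>i. i \<le> n \<Longrightarrow> x i < x (Suc i)"
begin

lemma x_mono: "i \<le> j \<Longrightarrow> j \<le> Suc n \<Longrightarrow> x i \<le> x j"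
proof (induction j rule: nat_induct_at_least[consumes 1])
  case base
  then show ?case by simp
next
  case (Suc j)
  then show ?case using x_step[of j] by simp
qed

lemma x_strict_mono: "i < j \<Longrightarrow> j \<le> Suc n \<Longrightarrow> x i < x j"
  using x_step[of i] x_mono[of "Suc i" j] by simp

lemma x_interior: "0 < i \<Longrightarrow> i \<le> n \<Longrightarrow> 0 < x i" "0 < i \<Longrightarrow> i \<le> n \<Longrightarrow> x i < l"
  using x_strict_mono[of 0 i] x_strict_mono[of i "Suc n"] by (auto simp: x_0 x_end)

lemma l_pos: "0 < l"
  using x_strict_mono[of 0 "Suc n"] by (simp add: x_0 x_end)

lemma element_exists:
  assumes "0 \<le> t" "t \<le> l"
  obtains j where "j \<le> n" "x j \<le> t" "t \<le> x (Suc j)"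
proof -
  define j where "j = (LEAST j. t \<le> x (Suc j))"
  have ex: "t \<le> x (Suc n)" using assms x_end by simp
  have 1: "t \<le> x (Suc j)" unfolding j_def using ex by (rule LeastI)
  have 2: "j \<le> n" unfolding j_def using ex by (rule Least_le)
  have 3: "x j \<le> t"
  proof (cases j)
    case 0
    then show ?thesis using assms x_0 by simp
  next
    case (Suc i)
    then have "\<not> t \<le> x (Suc i)" unfolding j_def by (intro not_less_Least) simp
    then show ?thesis using Suc by simp
  qed
  from 1 2 3 show ?thesis using that by blast
qed

text \<open>At a shared node the adjacent branches of \<open>hat\<close> take the same value, which
  is why closed elements can be used although they overlap.\<close>

lemma hat_on_element:
  assumes i: "0 < i" "i \<le> n" and j: "j \<le> n" and t: "x j \<le> t" "t \<le> x (Suc j)"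
  shows "hat x i t = (if i = j then (x (Suc j) - t) / (x (Suc j) - x j)
    else if i = Suc j then (t - x j) / (x (Suc j) - x j) else 0)"
proof -
  have *: "x (i - 1) < x i" "x i < x (i + 1)" "x j < x (Suc j)"
    using i j x_step[of "i - 1"] x_step[of i] x_step[of j] by auto
  consider "i < j" | "i = j" | "i = Suc j" | "i = Suc (Suc j)" | "Suc (Suc j) < i" by linarith
  then show ?thesis
  proof cases
    case 1
    then have "x (i + 1) \<le> x j" using j by (intro x_mono) auto
    then have "\<not> (x (i - 1) \<le> t \<and> t \<le> x i)" "x i < t \<and> t \<le> x (i + 1) \<Longrightarrow> x (i + 1) - t = 0"
      using * t by linarith+
    then have "hat x i t = 0" unfolding hat_def by auto
    with 1 show ?thesis by simp
  next
    case 2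
    show ?thesis
    proof (cases "t = x j")
      case True
      with 2 * show ?thesis by (simp add: hat_def)
    next
      case False
      with 2 * t have "hat x i t = (x (i + 1) - t) / (x (i + 1) - x i)" by (simp add: hat_def)
      with 2 show ?thesis by simp
    qed
  next
    case 3
    with * t show ?thesis by (simp add: hat_def)
  next
    case 4
    then have "x (i - 1) = x (Suc j)" by simp
    then have "x (i - 1) \<le> t \<and> t \<le> x i \<Longrightarrow> t - x (i - 1) = 0" "\<not> (x i < t \<and> t \<le> x (i + 1))"
      using * t by linarith+
    then have "hat x i t = 0" unfolding hat_def by auto
    with 4 show ?thesis by simp
  next
    case 5
    then have "x (Suc j) < x (i - 1)" using i by (intro x_strict_mono) auto
    then have "\<not> (x (i - 1) \<le> t \<and> t \<le> x i)" "\<not> (x i < t \<and> t \<le> x (i + 1))"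
      using * t by linarith+
    then have "hat x i t = 0" unfolding hat_def by auto
    with 5 show ?thesis by simp
  qed
qed

lemma hat_node:
  assumes "0 < i" "i \<le> n" "j \<le> Suc n"
  shows "hat x i (x j) = (if i = j then 1 else 0)"
proof (cases j)
  case 0
  then show ?thesis using hat_on_element[of i 0 "x 0"] x_step[of 0] assms by (simp split: if_splits)
next
  case (Suc m)
  have "x m < x (Suc m)" using x_step[of m] Suc assms by simp
  then show ?thesis
    using hat_on_element[of i m "x (Suc m)"] Suc assms by (simp split: if_splits)
qed

definition hat_slope :: "nat \<Rightarrow> nat \<Rightarrow> real" where
  "hat_slope i j = (if i = j then - 1 / (x (Suc j) - x j)
    else if i = Suc j then 1 / (x (Suc j) - x j) else 0)"

text \<open>The two expansions start from the left and from the right node of the element. Both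
  matter at \<open>x k\<close>, which is the right node of one element and the left node of the
  next.\<close>

lemma hat_affine_on_element:
  assumes i: "0 < i" "i \<le> n" and j: "j \<le> n" and t: "x j \<le> t" "t \<le> x (Suc j)"
  shows "hat x i t = hat x i (x j) + hat_slope i j * (t - x j)"
    and "hat x i t = hat x i (x (Suc j)) + hat_slope i j * (t - x (Suc j))"
proof -
  define d where "d = x (Suc j) - x j"
  have d: "d \<noteq> 0" "x (Suc j) = x j + d" using x_step j by (auto simp: d_def order_less_imp_not_eq2)
  have hat: "hat x i t = (if i = j then (x j + d - t) / d else if i = Suc j then (t - x j) / d else 0)"
    using hat_on_element[OF i j t] by (simp add: d)
  have slope: "hat_slope i j = (if i = j then - 1 / d else if i = Suc j then 1 / d else 0)"
    by (simp add: hat_slope_def d)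
  show "hat x i t = hat x i (x j) + hat_slope i j * (t - x j)"
    using hat_node[OF i, of j] i j d(1) unfolding hat slope
    by (simp add: diff_divide_distrib add_divide_distrib)
  show "hat x i t = hat x i (x (Suc j)) + hat_slope i j * (t - x (Suc j))"
    using hat_node[OF i, of "Suc j"] i j d(1) unfolding hat slope
    by (simp add: d(2) diff_divide_distrib add_divide_distrib)
qed

lemma hat_has_real_derivative:
  assumes i: "0 < i" "i \<le> n" and j: "j \<le> n" and t: "x j < t" "t < x (Suc j)"
  shows "(hat x i has_real_derivative hat_slope i j) (at t)"
proof -
  have "((\<lambda>t. hat x i (x j) + hat_slope i j * (t - x j)) has_real_derivative hat_slope i j) (at t)"
    by (auto intro!: derivative_eq_intros)
  then show ?thesis
    by (rule has_field_derivative_transform_within_open[where S="{x j<..<x (Suc j)}"])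
      (use t in \<open>auto intro!: hat_affine_on_element(1)[OF i j, symmetric]\<close>)
qed

lemma deriv_hat:
  assumes "0 < i" "i \<le> n" "j \<le> n" "x j < t" "t < x (Suc j)"
  shows "deriv (hat x i) t = hat_slope i j"
  using hat_has_real_derivative[OF assms] by (rule DERIV_imp_deriv)

lemma continuous_on_hat:
  assumes i: "0 < i" "i \<le> n"
  shows "continuous_on {0..l} (hat x i)"
proof -
  have "continuous_on (\<Union>j\<in>{..n}. {x j..x (Suc j)}) (hat x i)"
  proof (rule continuous_on_closed_Union)
    fix j assume "j \<in> {..n}"
    then have "hat x i t = hat x i (x j) + hat_slope i j * (t - x j)" if "t \<in> {x j..x (Suc j)}" for t
      using that by (intro hat_affine_on_element(1)[OF i]) auto
    then show "continuous_on {x j..x (Suc j)} (hat x i)"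
      by (rule continuous_on_eq[rotated, OF sym]) (auto intro!: continuous_intros)
  qed auto
  moreover have "{0..l} \<subseteq> (\<Union>j\<in>{..n}. {x j..x (Suc j)})"
    using element_exists by fastforce
  ultimately show ?thesis by (rule continuous_on_subset)
qed

lemma piecewise_diff_hat:
  assumes i: "0 < i" "i \<le> n"
  shows "piecewise_diff l (hat x i)"
  unfolding piecewise_diff_def
proof (intro conjI exI ballI)
  show "continuous_on {0..l} (hat x i)"
    by (rule continuous_on_hat[OF i])
  show "finite (x ` {..Suc n})" by simp
  fix t assume t: "t \<in> {0<..<l} - x ` {..Suc n}"
  then obtain j where j: "j \<le> n" "x j \<le> t" "t \<le> x (Suc j)"
    using element_exists[of t] by auto
  moreover from this have "t \<noteq> x j" "t \<noteq> x (Suc j)" using t by auto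
  ultimately have "x j < t" "t < x (Suc j)" by auto
  then have d: "(hat x i has_real_derivative hat_slope i j) (at t)"
    using hat_has_real_derivative i j by simp
  then show "hat x i differentiable at t"
    using real_differentiable_def by blast
  show "\<bar>deriv (hat x i) t\<bar> \<le> (\<Sum>j\<le>n. \<bar>hat_slope i j\<bar>)"
    unfolding DERIV_imp_deriv[OF d] using j(1) by (intro member_le_sum) auto
qed

text \<open>On an element only the hats at its two nodes can be nonzero, and together they reproduce
  affine functions. Affinity is demanded on the element of \<open>t\<close> alone, so
  \<open>g\<close> may have a kink at any node.\<close>

lemma interpolation:
  assumes g: "g 0 = 0" "g l = 0" and j: "j \<le> n" and t: "x j \<le> t" "t \<le> x (Suc j)"
    and affine: "\<And>t. x j \<le> t \<Longrightarrow> t \<le> x (Suc j) \<Longrightarrow> g t = a + b * t"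
  shows "(\<Sum>i<n. g (x (Suc i)) * NS x i t) = g t"
proof -
  define F where "F i = g (x i) * (if i = j then (x (Suc j) - t) / (x (Suc j) - x j)
    else if i = Suc j then (t - x j) / (x (Suc j) - x j) else 0)" for i
  have step: "x j < x (Suc j)" using x_step j by simp
  have "(\<Sum>i<n. g (x (Suc i)) * NS x i t) = (\<Sum>i<n. F (Suc i))"
    using hat_on_element[OF _ _ j t] by (intro sum.cong) (auto simp: F_def NS_def)
  \<comment> \<open>Adding the boundary nodes, where \<open>g\<close> vanishes, lets the elements at
    the two ends of the mesh be treated like all others.\<close>
  also have "\<dots> = (\<Sum>i<Suc (Suc n). F i)"
  proof -
    have "F 0 = 0" "F (Suc n) = 0"
      using g by (auto simp: F_def x_0 x_end)
    then show ?thesis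
      by (simp only: sum.lessThan_Suc_shift[of F "Suc n"] sum.lessThan_Suc[of "\<lambda>i. F (Suc i)" n])
  qed
  also have "\<dots> = (\<Sum>i\<in>{j, Suc j}. F i)"
    using j by (intro sum.mono_neutral_right) (auto simp: F_def)
  also have "\<dots> = g (x j) * ((x (Suc j) - t) / (x (Suc j) - x j)) + g (x (Suc j)) * ((t - x j) / (x (Suc j) - x j))"
    by (simp add: F_def)
  also have "\<dots> = g t"
  proof -
    have "(a + b * p) * ((q - t) / (q - p)) + (a + b * q) * ((t - p) / (q - p)) = a + b * t"
      if "p < q" for p q :: real
    proof -
      have "(a + b * p) * ((q - t) / (q - p)) + (a + b * q) * ((t - p) / (q - p))
          = ((a + b * t) * (q - p)) / (q - p)"
        unfolding times_divide_eq_right add_divide_distrib[symmetric]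
        by (rule arg_cong[where f="\<lambda>y. y / (q - p)"]) (simp add: algebra_simps)
      then show ?thesis using that by simp
    qed
    then show ?thesis
      using step t affine[of "x j"] affine[of "x (Suc j)"] affine[of t] by simp
  qed
  finally show ?thesis .
qed

text \<open>A kink at a node leaves the enrichment affine on every element. The case
  \<open>m = k\<close> is the relation \<open>N\<^sup>E = H N\<^sup>S\<close> at
  \<open>e = 0\<close>; the other nodes serve to invert the stiffness matrix.\<close>

lemma enrichment_interpolation:
  assumes m: "0 < m" "m \<le> n" and t: "0 \<le> t" "t \<le> l"
  shows "(\<Sum>i<n. enrichment l (x m) (x (Suc i)) * NS x i t) = enrichment l (x m) t"
proof -
  obtain j where j: "j \<le> n" "x j \<le> t" "t \<le> x (Suc j)"
    using element_exists t by blast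
  have xm: "0 < x m" "x m < l" using x_interior m by auto
  then have g: "enrichment l (x m) 0 = 0" "enrichment l (x m) l = 0"
    by (auto simp: enrichment_def)
  show ?thesis
  proof (cases "Suc j \<le> m")
    case True
    then have "x (Suc j) \<le> x m" using m by (intro x_mono) auto
    then show ?thesis
      by (intro interpolation[OF g j, where a=0 and b="1 / x m"]) (auto simp: enrichment_def)
  next
    case False
    then have "x m \<le> x j" using j by (intro x_mono) auto
    then have "enrichment l (x m) t = l / (l - x m) + - 1 / (l - x m) * t" if "x j \<le> t" for t
      using xm that enrichment_right[of "x m" l t] by (simp add: diff_divide_distrib)
    then show ?thesis
      by (rule interpolation[OF g j])
  qed
qed

end

section \<open>Entries of the enriched system\<close>

lemma right_differentiable_if_differentiable:
  assumes "G differentiable (at 0)" "0 < \<delta>" "\<And>e. 0 \<le> e \<Longrightarrow> e < \<delta> \<Longrightarrow> g e = G e"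
  shows "right_differentiable g"
  using assms right_quotient_tendsto unfolding right_differentiable_def real_differentiable_def by blast

lemma NE_eq_enrichment: "NE l c e b = enrichment l (if b = 0 then c - e else c + e)"
  by (simp add: NE_def fun_eq_iff)

locale inclusion = mesh +
  fixes l1 l2 :: real and k :: nat
  assumes node: "0 < k" "k \<le> n"
begin

definition c where "c = x k"

definition a :: "real \<Rightarrow> (real \<Rightarrow> real) \<Rightarrow> (real \<Rightarrow> real) \<Rightarrow> real" where
  "a e = energy l (diffusion l1 l2 c e)"

text \<open>The drop of the slope of \<open>enrichment l c\<close> at its kink, from
  \<open>1 / c\<close> to \<open>- 1 / (l - c)\<close>; it is also the energy of that function for
  the coefficient 1.\<close>

definition J :: real where "J = l / (c * (l - c))"

text \<open>Either row of \<open>H_mat\<close>, since the two enrichments coincide at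
  \<open>e = 0\<close>.\<close>

definition h :: "nat \<Rightarrow> real" where "h j = enrichment l c (x (Suc j))"

abbreviation (input) sL :: "nat \<Rightarrow> real" where "sL i \<equiv> hat_slope (Suc i) (k - 1)"

abbreviation (input) sR :: "nat \<Rightarrow> real" where "sR i \<equiv> hat_slope (Suc i) k"

lemma c_interior: "0 < c" "c < l"
  using x_interior node by (auto simp: c_def)

lemma J_pos: "0 < J"
  using c_interior by (simp add: J_def)

lemma eps_bar_pos: "0 < eps_bar x k"
  using x_step[of "k - 1"] x_step[of k] node by (simp add: eps_bar_def)

lemma eps_bar_le:
  assumes "e < eps_bar x k"
  shows "x (k - 1) < c - e" "c + e < x (Suc k)" "0 < c - e" "c + e < l"
proof -
  show 1: "x (k - 1) < c - e" "c + e < x (Suc k)"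
    using assms by (auto simp: eps_bar_def c_def)
  show "0 < c - e" "c + e < l"
    using 1 x_mono[of 0 "k - 1"] x_mono[of "Suc k" "Suc n"] node unfolding x_0 x_end by linarith+
qed

lemma piecewise_diff_NS: "i < n \<Longrightarrow> piecewise_diff l (NS x i)"
  unfolding NS_def by (intro piecewise_diff_hat) auto

lemma piecewise_diff_NE: "0 \<le> e \<Longrightarrow> e < eps_bar x k \<Longrightarrow> piecewise_diff l (NE l c e b)"
  unfolding NE_eq_enrichment using eps_bar_le[of e] by (intro piecewise_diff_enrichment) auto

lemma piecewise_diff_E: "piecewise_diff l (enrichment l c)"
  using piecewise_diff_enrichment c_interior by blast

lemma NS_near_node:
  assumes "i < n" "0 \<le> e" "e < eps_bar x k"
  shows "NS x i (c - e) = NS x i c - sL i * e" "NS x i (c + e) = NS x i c + sR i * e"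
  using hat_affine_on_element(2)[of "Suc i" "k - 1" "c - e"] hat_affine_on_element(1)[of "Suc i" k "c + e"]
    eps_bar_le[of e] assms node by (auto simp: NS_def c_def)

lemma NS_boundary: "i < n \<Longrightarrow> NS x i 0 = 0" "i < n \<Longrightarrow> NS x i l = 0"
  using hat_node[of "Suc i" 0] hat_node[of "Suc i" "Suc n"] by (auto simp: NS_def x_0 x_end)

lemma deriv_NS_near_node:
  assumes "i < n" "e < eps_bar x k"
  shows "t \<in> {c-e<..<c} \<Longrightarrow> deriv (NS x i) t = sL i" "t \<in> {c<..<c+e} \<Longrightarrow> deriv (NS x i) t = sR i"
  unfolding NS_def using assms node eps_bar_le[of e]
    deriv_hat[of "Suc i" "k - 1" t] deriv_hat[of "Suc i" k t] by (auto simp: c_def)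

section \<open>Matrix entries as explicit functions of the radius of the inclusion\<close>

lemma KS_entry: "i < n \<Longrightarrow> j < n \<Longrightarrow> KS l l1 l2 x n k e $$ (i, j) = a e (NS x i) (NS x j)"
  by (simp add: KS_def stiffness_def a_def energy_def c_def)

lemma KSE_entry: "i < n \<Longrightarrow> b < 2 \<Longrightarrow> KSE l l1 l2 x n k e $$ (i, b) = a e (NS x i) (NE l c e b)"
  by (simp add: KSE_def stiffness_def a_def energy_def c_def)

lemma KE_entry: "b < 2 \<Longrightarrow> d < 2 \<Longrightarrow> KE l l1 l2 x k e $$ (b, d) = a e (NE l c e b) (NE l c e d)"
  by (simp add: KE_def stiffness_def a_def energy_def c_def)

lemma a_commute: "a e v w = a e w v"
  by (simp add: a_def energy_commute)

lemma a_split: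
  assumes "piecewise_diff l v" "piecewise_diff l w" "0 \<le> e" "e < eps_bar x k"
    "\<And>t. t \<in> {c-e<..<c} \<Longrightarrow> deriv v t = p1" "\<And>t. t \<in> {c<..<c+e} \<Longrightarrow> deriv v t = p2"
    "\<And>t. t \<in> {c-e<..<c} \<Longrightarrow> deriv w t = q1" "\<And>t. t \<in> {c<..<c+e} \<Longrightarrow> deriv w t = q2"
  shows "a e v w = l1 * energy l (\<lambda>t. 1) v w + (l2 - l1) * (e * (p1 * q1 + p2 * q2))"
  unfolding a_def using assms eps_bar_le[of e] by (intro energy_diffusion) auto

lemma a_NS_NS:
  assumes "i < n" "j < n" "0 \<le> e" "e < eps_bar x k"
  shows "a e (NS x i) (NS x j) = l1 * energy l (\<lambda>t. 1) (NS x i) (NS x j)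
    + (l2 - l1) * (e * (sL i * sL j + sR i * sR j))"
  using assms by (intro a_split piecewise_diff_NS deriv_NS_near_node) auto

definition \<kappa> where "\<kappa> e b = (if b = (0::nat) then c - e else c + e)"

text \<open>The slope of an enrichment on the inclusion. The kinks are the end points of the
  inclusion, so the enrichment of index 0 is on its falling branch there and the other one on its
  rising branch.\<close>

definition q where "q e b = (if b = (0::nat) then - 1 / (l - (c - e)) else 1 / (c + e))"

lemma NE_\<kappa>: "NE l c e b = enrichment l (\<kappa> e b)"
  by (simp add: NE_eq_enrichment \<kappa>_def)

lemma \<kappa>_interior: "0 \<le> e \<Longrightarrow> e < eps_bar x k \<Longrightarrow> 0 < \<kappa> e b" "0 \<le> e \<Longrightarrow> e < eps_bar x k \<Longrightarrow> \<kappa> e b < l"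
  using eps_bar_le[of e] by (auto simp: \<kappa>_def)

lemma deriv_NE_near_node:
  assumes "0 \<le> e" "e < eps_bar x k"
  shows "t \<in> {c-e<..<c} \<Longrightarrow> deriv (NE l c e b) t = q e b"
    "t \<in> {c<..<c+e} \<Longrightarrow> deriv (NE l c e b) t = q e b"
proof -
  have "deriv (NE l c e b) t = q e b" if "t \<in> {c-e<..<c} \<or> t \<in> {c<..<c+e}"
    unfolding NE_\<kappa> using that assms \<kappa>_interior[OF assms, of b]
    by (cases "b = 0") (auto simp: deriv_enrichment \<kappa>_def q_def)
  then show "t \<in> {c-e<..<c} \<Longrightarrow> deriv (NE l c e b) t = q e b"
    "t \<in> {c<..<c+e} \<Longrightarrow> deriv (NE l c e b) t = q e b"
    by blast+
qed

lemma deriv_E_near_node: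
  assumes "e < eps_bar x k"
  shows "t \<in> {c-e<..<c} \<Longrightarrow> deriv (enrichment l c) t = 1 / c"
    "t \<in> {c<..<c+e} \<Longrightarrow> deriv (enrichment l c) t = - 1 / (l - c)"
  using c_interior by (auto simp: deriv_enrichment)

lemma energy_NE:
  assumes "piecewise_diff l v" "v 0 = 0" "v l = 0" "0 \<le> e" "e < eps_bar x k"
  shows "energy l (\<lambda>t. 1) v (NE l c e b) = v (\<kappa> e b) * (l / (\<kappa> e b * (l - \<kappa> e b)))"
  unfolding NE_\<kappa> using assms by (intro energy_enrichment \<kappa>_interior)

lemma a_NS_NE:
  assumes "i < n" "0 \<le> e" "e < eps_bar x k"
  shows "a e (NS x i) (NE l c e b) = l1 * (NS x i (\<kappa> e b) * (l / (\<kappa> e b * (l - \<kappa> e b))))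
    + (l2 - l1) * (e * (sL i * q e b + sR i * q e b))"
  unfolding energy_NE[OF piecewise_diff_NS[OF assms(1)] NS_boundary[OF assms(1)] assms(2,3), symmetric]
  by (rule a_split[OF piecewise_diff_NS[OF assms(1)] piecewise_diff_NE[OF assms(2,3)] assms(2,3)])
    (erule deriv_NS_near_node[OF assms(1,3)] deriv_NE_near_node[OF assms(2,3)])+

lemma NE_boundary:
  assumes "0 \<le> e" "e < eps_bar x k"
  shows "NE l c e b 0 = 0" "NE l c e b l = 0"
  unfolding NE_\<kappa> using \<kappa>_interior[OF assms, of b] by (auto simp: enrichment_def)

lemma E_boundary: "enrichment l c 0 = 0" "enrichment l c l = 0"
  using c_interior by (auto simp: enrichment_def)

lemma a_NE_NE:
  assumes "0 \<le> e" "e < eps_bar x k"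
  shows "a e (NE l c e b) (NE l c e d) = l1 * (enrichment l (\<kappa> e b) (\<kappa> e d) * (l / (\<kappa> e d * (l - \<kappa> e d))))
    + (l2 - l1) * (e * (q e b * q e d + q e b * q e d))"
  unfolding NE_\<kappa>[symmetric]
    energy_NE[OF piecewise_diff_NE[OF assms] NE_boundary[OF assms] assms, symmetric]
  by (rule a_split[OF piecewise_diff_NE[OF assms] piecewise_diff_NE[OF assms] assms])
    (erule deriv_NE_near_node[OF assms])+

lemma a_NE_E:
  assumes "0 \<le> e" "e < eps_bar x k"
  shows "a e (NE l c e b) (enrichment l c) = l1 * (enrichment l (\<kappa> e b) c * J)
    + (l2 - l1) * (e * (q e b * (1 / c) + q e b * (- 1 / (l - c))))"
  unfolding J_def NE_\<kappa>[symmetric]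
    energy_enrichment[OF piecewise_diff_NE[OF assms] NE_boundary[OF assms] c_interior, symmetric]
  by (rule a_split[OF piecewise_diff_NE[OF assms] piecewise_diff_E assms])
    (erule deriv_NE_near_node[OF assms] deriv_E_near_node[OF assms(2)])+

lemma a_E_E:
  assumes "0 \<le> e" "e < eps_bar x k"
  shows "a e (enrichment l c) (enrichment l c) = l1 * J
    + (l2 - l1) * (e * (1 / c * (1 / c) + (- 1 / (l - c)) * (- 1 / (l - c))))"
proof -
  have "energy l (\<lambda>t. 1) (enrichment l c) (enrichment l c) = enrichment l c c * (l / (c * (l - c)))"
    by (rule energy_enrichment[OF piecewise_diff_E E_boundary c_interior])
  also have "\<dots> = J"
    using c_interior by (simp add: J_def enrichment_def)
  finally have J: "energy l (\<lambda>t. 1) (enrichment l c) (enrichment l c) = J" .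
  show ?thesis
    unfolding J[symmetric]
    by (rule a_split[OF piecewise_diff_E piecewise_diff_E assms])
      (erule deriv_E_near_node[OF assms(2)])+
qed

lemma right_differentiable_KS:
  assumes "i < n" "j < n"
  shows "right_differentiable (\<lambda>e. KS l l1 l2 x n k e $$ (i, j))"
  by (rule right_differentiable_if_differentiable[OF _ eps_bar_pos, where G="\<lambda>e. l1 * energy l (\<lambda>t. 1) (NS x i) (NS x j)
    + (l2 - l1) * (e * (sL i * sL j + sR i * sR j))"])
    (use assms in \<open>auto simp: KS_entry a_NS_NS\<close>)

text \<open>The entry agrees with a rational function of \<open>e\<close> that is regular at 0. The
  hat at the moving kink is expanded with its slope left of the node for the kink
  \<open>c - e\<close> and with its slope right of the node for \<open>c + e\<close>, hence the case
  distinction.\<close>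

lemma right_differentiable_KSE:
  assumes i: "i < n" and b: "b < 2"
  shows "right_differentiable (\<lambda>e. KSE l l1 l2 x n k e $$ (i, b))"
proof (rule right_differentiable_if_differentiable[OF _ eps_bar_pos])
  fix e assume "0 \<le> e" "e < eps_bar x k"
  then show "KSE l l1 l2 x n k e $$ (i, b)
    = l1 * ((NS x i c + (if b = 0 then - sL i else sR i) * e) * (l / (\<kappa> e b * (l - \<kappa> e b))))
      + (l2 - l1) * (e * (sL i * q e b + sR i * q e b))"
    using i b by (auto simp: KSE_entry a_NS_NE \<kappa>_def NS_near_node)
next
  show "(\<lambda>e. l1 * ((NS x i c + (if b = 0 then - sL i else sR i) * e) * (l / (\<kappa> e b * (l - \<kappa> e b))))
      + (l2 - l1) * (e * (sL i * q e b + sR i * q e b))) differentiable (at 0)"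
    using c_interior unfolding \<kappa>_def q_def
    by (cases "b = 0") (auto intro!: derivative_intros)
qed

section \<open>The system for hats and differences of enrichments\<close>

lemma sum_h_NS: "t \<in> {0<..<l} \<Longrightarrow> (\<Sum>i<n. h i * NS x i t) = enrichment l c t"
  unfolding h_def c_def using node by (intro enrichment_interpolation) auto

lemma sum_h_a:
  assumes "piecewise_diff l w"
  shows "(\<Sum>i<n. h i * a e (NS x i) w) = a e (enrichment l c) w"
  unfolding a_def using assms l_pos
  by (intro energy_sum[OF _ _ _ _ diffusion_measurable diffusion_bound sum_h_NS] piecewise_diff_NS piecewise_diff_E) auto

text \<open>The energy of \<open>NS x i\<close> with \<open>NE l c e b - enrichment l c\<close>,
  because \<open>h\<close> holds the nodal values of \<open>enrichment l c\<close>.\<close>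

definition B :: "real \<Rightarrow> nat \<Rightarrow> nat \<Rightarrow> real" where
  "B e i b = KSE l l1 l2 x n k e $$ (i, b) - (\<Sum>j<n. KS l l1 l2 x n k e $$ (i, j) * h j)"

text \<open>The energy of the differences \<open>NE l c e b - enrichment l c\<close> and
  \<open>NE l c e d - enrichment l c\<close>, expanded by bilinearity.\<close>

definition C :: "real \<Rightarrow> nat \<Rightarrow> nat \<Rightarrow> real" where
  "C e b d = KE l l1 l2 x k e $$ (b, d) - (\<Sum>i<n. h i * KSE l l1 l2 x n k e $$ (i, d))
    - (\<Sum>i<n. h i * KSE l l1 l2 x n k e $$ (i, b)) + (\<Sum>i<n. h i * (\<Sum>j<n. KS l l1 l2 x n k e $$ (i, j) * h j))"

lemma B_0: "i < n \<Longrightarrow> b < 2 \<Longrightarrow> B 0 i b = 0"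
  using sum_h_a[OF piecewise_diff_NS, of i 0]
  by (simp add: B_def KSE_entry KS_entry NE_eq_enrichment a_commute[of _ "NS x i"] mult.commute)

lemma C_eq:
  assumes e: "0 \<le> e" "e < eps_bar x k" and bd: "b < 2" "d < 2"
  shows "C e b d = a e (NE l c e b) (NE l c e d) - a e (NE l c e d) (enrichment l c)
    - a e (NE l c e b) (enrichment l c) + a e (enrichment l c) (enrichment l c)"
proof -
  have 1: "(\<Sum>i<n. h i * KSE l l1 l2 x n k e $$ (i, b)) = a e (NE l c e b) (enrichment l c)" if "b < 2" for b
    using that sum_h_a[OF piecewise_diff_NE[OF e], of e b] by (simp add: KSE_entry a_commute)
  have "(\<Sum>j<n. KS l l1 l2 x n k e $$ (i, j) * h j) = a e (NS x i) (enrichment l c)" if "i < n" for i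
    using that sum_h_a[OF piecewise_diff_NS[OF that], of e]
    by (simp add: KS_entry a_commute[of _ "NS x i"] mult.commute)
  then show ?thesis
    using bd sum_h_a[OF piecewise_diff_E, of e] by (simp add: C_def KE_entry 1)
qed

text \<open>Row \<open>m\<close> of the inverse holds the nodal values of the Green's function with
  pole \<open>x (Suc m)\<close>: testing with a hat evaluates that hat at the pole. The second
  factor cancels the normalisation \<open>l1 * (l / (y * (l - y)))\<close>.\<close>

lemma stiffness_left_inverse:
  assumes m: "m < n" and j: "j < n" and l1: "l1 \<noteq> 0"
  shows "(\<Sum>i<n. enrichment l (x (Suc m)) (x (Suc i)) * ((x (Suc m) * (l - x (Suc m))) / (l1 * l))
      * KS l l1 l2 x n k 0 $$ (i, j)) = (if m = j then 1 else 0)"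
proof -
  define y where "y = x (Suc m)"
  have y: "0 < y" "y < l" using x_interior[of "Suc m"] m by (auto simp: y_def)
  have "(\<Sum>i<n. enrichment l y (x (Suc i)) * energy l (diffusion l1 l2 c 0) (NS x i) (NS x j))
      = energy l (diffusion l1 l2 c 0) (enrichment l y) (NS x j)"
    using j m l_pos enrichment_interpolation[of "Suc m"] unfolding y_def[symmetric]
    by (intro energy_sum[OF _ _ _ _ diffusion_measurable diffusion_bound] piecewise_diff_NS piecewise_diff_enrichment y) auto
  also have "\<dots> = energy l (diffusion l1 l2 c 0) (NS x j) (enrichment l y)"
    by (rule energy_commute)
  also have "\<dots> = l1 * energy l (\<lambda>t. 1) (NS x j) (enrichment l y)"
    using energy_diffusion[OF piecewise_diff_NS[OF j] piecewise_diff_enrichment[OF y], of 0 c] c_interior by simp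
  also have "\<dots> = l1 * ((if m = j then 1 else 0) * (l / (y * (l - y))))"
    using energy_enrichment[OF piecewise_diff_NS[OF j] NS_boundary[OF j] y] hat_node[of "Suc j" "Suc m"] j m
    by (simp add: NS_def y_def)
  finally have *: "(\<Sum>i<n. enrichment l y (x (Suc i)) * KS l l1 l2 x n k 0 $$ (i, j))
      = l1 * ((if m = j then 1 else 0) * (l / (y * (l - y))))"
    using j by (simp add: KS_entry a_def)
  have "(\<Sum>i<n. enrichment l y (x (Suc i)) * ((y * (l - y)) / (l1 * l)) * KS l l1 l2 x n k 0 $$ (i, j))
      = (y * (l - y)) / (l1 * l) * (\<Sum>i<n. enrichment l y (x (Suc i)) * KS l l1 l2 x n k 0 $$ (i, j))"
    unfolding sum_distrib_left by (intro sum.cong) (auto simp: mult_ac)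
  also have "\<dots> = (if m = j then 1 else 0)"
    unfolding * using y l1 l_pos by simp
  finally show ?thesis by (simp add: y_def)
qed

text \<open>\<open>P\<close> comes with the uniform material \<open>l1\<close> and \<open>R\<close>
  with the change of material on the inclusion. On the diagonal \<open>P e / e\<close> and
  \<open>R e\<close> both tend to \<open>J\<^sup>2\<close>, so the limit is
  \<open>l1 * J\<^sup>2 + (l2 - l1) * J\<^sup>2\<close> and only the material inside the inclusion
  survives.\<close>

lemma C_quotient_tendsto:
  assumes bd: "b < 2" "d < 2"
  shows "((\<lambda>e. C e b d / e) \<longlongrightarrow> (if b = d then l2 * J\<^sup>2 else 0)) (at_right 0)"
proof -
  define m where "m = l - c"
  have m: "0 < m" "0 < c" "l = c + m" using c_interior by (auto simp: m_def)
  \<comment> \<open>Off the diagonal the four energies factor into two differences that both vanish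
    at \<open>e = 0\<close>, so no term of first order remains.\<close>
  define P where "P e = l * (if b = d then
       (if b = 0 then 1 / ((c - e) * (m + e)) - 2 / (c * (m + e)) + 1 / (c * m)
        else 1 / ((c + e) * (m - e)) - 2 / ((c + e) * m) + 1 / (c * m))
     else (1 / (c + e) - 1 / c) * (1 / (m + e) - 1 / m))" for e
  \<comment> \<open>The slopes of the differences, multiplied on the left and on the right half of
    the inclusion, where \<open>enrichment l c\<close> has the slopes \<open>1 / c\<close> and
    \<open>- 1 / m\<close>.\<close>
  define R where "R e = (q e b - 1 / c) * (q e d - 1 / c) + (q e b + 1 / m) * (q e d + 1 / m)" for e
  have C: "C e b d = l1 * P e + (l2 - l1) * (e * R e)" if e: "0 \<le> e" "e < eps_bar x k" for e
  proof -
    have ce: "0 < c - e" "0 < m - e" using eps_bar_le[OF e(2)] by (auto simp: m_def)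
    have bd': "(b = 0 \<or> b = 1) \<and> (d = 0 \<or> d = 1)" using bd by auto
    have E: "enrichment l (c - e) (c - e) = 1" "enrichment l (c + e) (c + e) = 1"
      "enrichment l (c - e) (c + e) = (m - e) / (m + e)" "enrichment l (c + e) (c - e) = (c - e) / (c + e)"
      "enrichment l (c - e) c = m / (m + e)" "enrichment l (c + e) c = c / (c + e)"
    proof -
      have me: "m - e = l - (c + e)" "m + e = l - (c - e)" by (auto simp: m_def)
      show "enrichment l (c - e) (c - e) = 1" "enrichment l (c + e) (c + e) = 1"
        "enrichment l (c - e) (c + e) = (m - e) / (m + e)" "enrichment l (c + e) (c - e) = (c - e) / (c + e)"
        "enrichment l (c - e) c = m / (m + e)" "enrichment l (c + e) c = c / (c + e)"
        unfolding me using ce e(1) c_interior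
        by (auto simp: enrichment_right m_def) (auto simp: enrichment_def)
    qed
    have J: "J = l / (c * m)" "l / ((c - e) * (l - (c - e))) = l / ((c - e) * (m + e))"
      "l / ((c + e) * (l - (c + e))) = l / ((c + e) * (m - e))"
      by (auto simp: J_def m_def algebra_simps)
    have "enrichment l (\<kappa> e b) (\<kappa> e d) * (l / (\<kappa> e d * (l - \<kappa> e d)))
        - enrichment l (\<kappa> e d) c * J - enrichment l (\<kappa> e b) c * J + J = P e"
    proof -
      have cancel: "m / (m + e) * (l / (c * m)) = l / (c * (m + e))"
        "c / (c + e) * (l / (c * m)) = l / ((c + e) * m)"
        "(m - e) / (m + e) * (l / ((c + e) * (m - e))) = l / ((c + e) * (m + e))"
        "(c - e) / (c + e) * (l / ((c - e) * (m + e))) = l / ((c + e) * (m + e))"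
        using m(1,2) ce e(1) by simp_all
      have diagonal: "1 * (l / A) - l / B - l / B + l / D = l * (1 / A - 2 / B + 1 / D)" for A B D
        by (simp add: algebra_simps)
      have "l / ((c + e) * (m + e)) - l / ((c + e) * m) - l / (c * (m + e)) + l / (c * m)
          = l * ((1 / (c + e) - 1 / c) * (1 / (m + e) - 1 / m))"
        by (simp add: left_diff_distrib right_diff_distrib diff_divide_distrib)
      moreover from this have "l / ((c + e) * (m + e)) - l / (c * (m + e)) - l / ((c + e) * m) + l / (c * m)
          = l * ((1 / (c + e) - 1 / c) * (1 / (m + e) - 1 / m))"
        by simp
      ultimately show ?thesis
        using bd' by (elim conjE disjE) (simp_all only: \<kappa>_def P_def E J cancel diagonal if_True if_False refl zero_neq_one one_neq_zero)
    qed
    moreover have "C e b d = l1 * (enrichment l (\<kappa> e b) (\<kappa> e d) * (l / (\<kappa> e d * (l - \<kappa> e d)))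
        - enrichment l (\<kappa> e d) c * J - enrichment l (\<kappa> e b) c * J + J) + (l2 - l1) * (e * R e)"
      unfolding C_eq[OF e bd] a_NE_NE[OF e] a_NE_E[OF e] a_E_E[OF e] R_def m_def
      by (simp add: algebra_simps)
    ultimately show ?thesis by simp
  qed
  have P: "(P has_real_derivative (if b = d then J\<^sup>2 else 0)) (at 0)"
  proof -
    have "((\<lambda>e. 1 / ((c - e) * (m + e)) - 2 / (c * (m + e)) + 1 / (c * m)) has_real_derivative l / (c * m)\<^sup>2) (at 0)"
      unfolding m(3)
      by (rule derivative_eq_intros refl | use m in \<open>simp; fail\<close>)+
        (use m(1,2) in \<open>simp add: divide_simps power2_eq_square\<close>)
    moreover have "((\<lambda>e. 1 / ((c + e) * (m - e)) - 2 / ((c + e) * m) + 1 / (c * m)) has_real_derivative l / (c * m)\<^sup>2) (at 0)"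
      unfolding m(3)
      by (rule derivative_eq_intros refl | use m in \<open>simp; fail\<close>)+
        (use m(1,2) in \<open>simp add: divide_simps power2_eq_square\<close>)
    moreover have "((\<lambda>e. (1 / (c + e) - 1 / c) * (1 / (m + e) - 1 / m)) has_real_derivative 0) (at 0)"
      using m(1,2) by (auto intro!: derivative_eq_intros)
    ultimately have "(P has_real_derivative l * (if b = d then l / (c * m)\<^sup>2 else 0)) (at 0)"
      unfolding P_def by (intro DERIV_cmult) (cases "b = d"; cases "b = 0"; simp)
    moreover have "l * (l / (c * m)\<^sup>2) = J\<^sup>2"
      by (simp add: J_def m_def power_divide power2_eq_square)
    ultimately show ?thesis by (simp split: if_splits)
  qed
  have R: "R \<midarrow>0\<rightarrow> (if b = d then J\<^sup>2 else 0)"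
  proof -
    have "(\<lambda>e. q e b) \<midarrow>0\<rightarrow> (if b = 0 then - 1 / m else 1 / c)" for b
      unfolding q_def m_def using c_interior by (cases "b = 0") (auto intro!: tendsto_eq_intros)
    then have "R \<midarrow>0\<rightarrow> ((if b = 0 then - 1 / m else 1 / c) - 1 / c) * ((if d = 0 then - 1 / m else 1 / c) - 1 / c)
        + ((if b = 0 then - 1 / m else 1 / c) + 1 / m) * ((if d = 0 then - 1 / m else 1 / c) + 1 / m)"
      unfolding R_def by (intro tendsto_intros)
    moreover have J: "J = 1 / m + 1 / c"
      using c_interior by (simp add: J_def m_def divide_simps)
    have "((if b = 0 then - 1 / m else 1 / c) - 1 / c) * ((if d = 0 then - 1 / m else 1 / c) - 1 / c)
        + ((if b = 0 then - 1 / m else 1 / c) + 1 / m) * ((if d = 0 then - 1 / m else 1 / c) + 1 / m)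
        = (if b = d then J\<^sup>2 else 0)"
      using bd unfolding J by (auto simp: less_2_cases_iff power2_eq_square algebra_simps)
    ultimately show ?thesis by simp
  qed
  have "(R \<longlongrightarrow> (if b = d then J\<^sup>2 else 0)) (at_right 0)"
    using R by (rule tendsto_within_subset) simp
  moreover have "(right_quotient P \<longlongrightarrow> (if b = d then J\<^sup>2 else 0)) (at_right 0)"
    by (rule right_quotient_tendsto[OF P eps_bar_pos]) simp
  ultimately have "((\<lambda>e. l1 * right_quotient P e + (l2 - l1) * R e)
      \<longlongrightarrow> l1 * (if b = d then J\<^sup>2 else 0) + (l2 - l1) * (if b = d then J\<^sup>2 else 0)) (at_right 0)"
    by (intro tendsto_intros)
  moreover have P0: "P 0 = 0"
    using m by (simp add: P_def field_simps)
  have "\<forall>\<^sub>F e in at_right 0. l1 * right_quotient P e + (l2 - l1) * R e = C e b d / e"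
    using eventually_at_right_less[of 0] eventually_at_right_real[OF eps_bar_pos]
    by eventually_elim (simp add: C P0 right_quotient_def add_divide_distrib)
  ultimately have "((\<lambda>e. C e b d / e) \<longlongrightarrow> l1 * (if b = d then J\<^sup>2 else 0) + (l2 - l1) * (if b = d then J\<^sup>2 else 0)) (at_right 0)"
    by (rule Lim_transform_eventually)
  then show ?thesis by (simp add: algebra_simps split: if_splits)
qed

end

section \<open>Perturbed linear systems and the objective\<close>

text \<open>The left inverse gives \<open>d = L (\<rho> - (A - A0) d)\<close> for the error
  \<open>d = z - y\<close>. Summing absolute values yields \<open>N \<le> R + D * N\<close> with
  \<open>R\<close> and \<open>D\<close> tending to 0, and once \<open>D < 1 / 2\<close> the last
  term is absorbed. Boundedness of \<open>z\<close> is thus a result and not a premise.\<close>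

lemma perturbed_system_tendsto:
  fixes A :: "'a \<Rightarrow> 'i \<Rightarrow> 'i \<Rightarrow> real"
  assumes I: "finite I"
    and inv: "\<And>m j. m \<in> I \<Longrightarrow> j \<in> I \<Longrightarrow> (\<Sum>i\<in>I. L m i * A0 i j) = (if m = j then 1 else 0)"
    and A: "\<And>i j. i \<in> I \<Longrightarrow> j \<in> I \<Longrightarrow> ((\<lambda>e. A e i j) \<longlongrightarrow> A0 i j) F"
    and rhs: "\<And>i. i \<in> I \<Longrightarrow> ((\<lambda>e. \<Sum>j\<in>I. A e i j * z e j) \<longlongrightarrow> (\<Sum>j\<in>I. A0 i j * y j)) F"
    and m: "m \<in> I"
  shows "((\<lambda>e. z e m) \<longlongrightarrow> y m) F"
proof -
  define d where "d e j = z e j - y j" for e j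
  define \<rho> where "\<rho> e i = (\<Sum>j\<in>I. A e i j * d e j)" for e i
  define N where "N e = (\<Sum>j\<in>I. \<bar>d e j\<bar>)" for e
  define R where "R e = (\<Sum>m\<in>I. \<Sum>i\<in>I. \<bar>L m i\<bar> * \<bar>\<rho> e i\<bar>)" for e
  define D where "D e = (\<Sum>m\<in>I. \<Sum>i\<in>I. \<bar>L m i\<bar> * (\<Sum>j\<in>I. \<bar>A e i j - A0 i j\<bar>))" for e
  have \<rho>: "((\<lambda>e. \<rho> e i) \<longlongrightarrow> 0) F" if i: "i \<in> I" for i
  proof -
    have "((\<lambda>e. (\<Sum>j\<in>I. A e i j * z e j) - (\<Sum>j\<in>I. A e i j * y j))
        \<longlongrightarrow> (\<Sum>j\<in>I. A0 i j * y j) - (\<Sum>j\<in>I. A0 i j * y j)) F"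
      using i by (intro tendsto_diff rhs tendsto_sum tendsto_mult A tendsto_const)
    then show ?thesis
      by (simp add: \<rho>_def d_def right_diff_distrib sum_subtractf)
  qed
  have N_nonneg: "0 \<le> N e" and d_le_N: "j \<in> I \<Longrightarrow> \<bar>d e j\<bar> \<le> N e" for e j
    unfolding N_def using I by (auto intro: sum_nonneg member_le_sum)
  have bound: "N e \<le> R e + D e * N e" for e
  proof -
    have "\<bar>d e m\<bar> \<le> (\<Sum>i\<in>I. \<bar>L m i\<bar> * \<bar>\<rho> e i\<bar>) + (\<Sum>i\<in>I. \<bar>L m i\<bar> * (\<Sum>j\<in>I. \<bar>A e i j - A0 i j\<bar>)) * N e"
      if m: "m \<in> I" for m
    proof -
      have "d e m = (\<Sum>j\<in>I. (\<Sum>i\<in>I. L m i * A0 i j) * d e j)"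
        using inv[OF m] I m by (simp add: if_distrib[of "\<lambda>x. x * _"] cong: if_cong)
      also have "\<dots> = (\<Sum>i\<in>I. L m i * (\<Sum>j\<in>I. A0 i j * d e j))"
        unfolding sum_distrib_left sum_distrib_right by (subst sum.swap) (simp add: mult.assoc)
      also have "\<dots> = (\<Sum>i\<in>I. L m i * (\<rho> e i - (\<Sum>j\<in>I. (A e i j - A0 i j) * d e j)))"
        by (simp add: \<rho>_def left_diff_distrib sum_subtractf)
      finally have "\<bar>d e m\<bar> \<le> (\<Sum>i\<in>I. \<bar>L m i * (\<rho> e i - (\<Sum>j\<in>I. (A e i j - A0 i j) * d e j))\<bar>)"
        by (simp add: sum_abs)
      also have "\<dots> \<le> (\<Sum>i\<in>I. \<bar>L m i\<bar> * \<bar>\<rho> e i\<bar> + \<bar>L m i\<bar> * (\<Sum>j\<in>I. \<bar>A e i j - A0 i j\<bar>) * N e)"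
      proof (rule sum_mono)
        fix i assume "i \<in> I"
        have "\<bar>\<Sum>j\<in>I. (A e i j - A0 i j) * d e j\<bar> \<le> (\<Sum>j\<in>I. \<bar>A e i j - A0 i j\<bar> * N e)"
          by (rule order_trans[OF sum_abs]) (auto simp: abs_mult intro!: sum_mono mult_left_mono d_le_N)
        then have "\<bar>\<rho> e i - (\<Sum>j\<in>I. (A e i j - A0 i j) * d e j)\<bar>
            \<le> \<bar>\<rho> e i\<bar> + (\<Sum>j\<in>I. \<bar>A e i j - A0 i j\<bar>) * N e"
          unfolding sum_distrib_right by linarith
        then have "\<bar>L m i\<bar> * \<bar>\<rho> e i - (\<Sum>j\<in>I. (A e i j - A0 i j) * d e j)\<bar>
            \<le> \<bar>L m i\<bar> * (\<bar>\<rho> e i\<bar> + (\<Sum>j\<in>I. \<bar>A e i j - A0 i j\<bar>) * N e)"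
          by (rule mult_left_mono) simp
        then show "\<bar>L m i * (\<rho> e i - (\<Sum>j\<in>I. (A e i j - A0 i j) * d e j))\<bar>
            \<le> \<bar>L m i\<bar> * \<bar>\<rho> e i\<bar> + \<bar>L m i\<bar> * (\<Sum>j\<in>I. \<bar>A e i j - A0 i j\<bar>) * N e"
          by (simp add: abs_mult distrib_left mult.assoc)
      qed
      finally show ?thesis by (simp add: sum.distrib sum_distrib_right)
    qed
    then have "N e \<le> (\<Sum>m\<in>I. (\<Sum>i\<in>I. \<bar>L m i\<bar> * \<bar>\<rho> e i\<bar>)
        + (\<Sum>i\<in>I. \<bar>L m i\<bar> * (\<Sum>j\<in>I. \<bar>A e i j - A0 i j\<bar>)) * N e)"
      unfolding N_def[of e] by (rule sum_mono)
    then show ?thesis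
      by (simp add: R_def D_def sum.distrib sum_distrib_right)
  qed
  have "(D \<longlongrightarrow> (\<Sum>m\<in>I. \<Sum>i\<in>I. \<bar>L m i\<bar> * (\<Sum>j\<in>I. \<bar>A0 i j - A0 i j\<bar>))) F"
    unfolding D_def by (intro tendsto_intros A)
  then have "\<forall>\<^sub>F e in F. D e < 1 / 2"
    by (intro order_tendstoD(2)) auto
  then have "\<forall>\<^sub>F e in F. N e \<le> 2 * R e"
  proof (eventually_elim)
    case (elim e)
    then have "D e * N e \<le> 1 / 2 * N e" using N_nonneg[of e] by (intro mult_right_mono) auto
    then show ?case using bound[of e] by linarith
  qed
  then have "\<forall>\<^sub>F e in F. norm (d e m) \<le> 2 * R e"
    by (rule eventually_mono) (use d_le_N[OF m] in \<open>simp, metis order_trans\<close>)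
  moreover have "((\<lambda>e. 2 * R e) \<longlongrightarrow> 2 * (\<Sum>m\<in>I. \<Sum>i\<in>I. \<bar>L m i\<bar> * \<bar>0\<bar>)) F"
    unfolding R_def by (intro tendsto_intros \<rho>)
  then have "((\<lambda>e. 2 * R e) \<longlongrightarrow> 0) F"
    by simp
  ultimately have "((\<lambda>e. d e m) \<longlongrightarrow> 0) F"
    by (rule Lim_null_comparison)
  then show ?thesis
    unfolding d_def by (simp add: LIM_zero_iff)
qed

text \<open>The limit matrix is block lower triangular and is inverted by forward substitution.
  Indexing both groups of unknowns by a sum type reduces the claim to a single linear
  system.\<close>

lemma perturbed_block_system_tendsto:
  fixes K :: "'a \<Rightarrow> 'i \<Rightarrow> 'i \<Rightarrow> real" and B :: "'a \<Rightarrow> 'i \<Rightarrow> 'j \<Rightarrow> real"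
  assumes I: "finite I" and I': "finite I'" and \<delta>: "\<delta> \<noteq> 0"
    and inv: "\<And>m j. m \<in> I \<Longrightarrow> j \<in> I \<Longrightarrow> (\<Sum>i\<in>I. L m i * K0 i j) = (if m = j then 1 else 0)"
    and K: "\<And>i j. i \<in> I \<Longrightarrow> j \<in> I \<Longrightarrow> ((\<lambda>e. K e i j) \<longlongrightarrow> K0 i j) F"
    and B: "\<And>i b. i \<in> I \<Longrightarrow> b \<in> I' \<Longrightarrow> ((\<lambda>e. B e i b) \<longlongrightarrow> 0) F"
    and B': "\<And>i b. i \<in> I \<Longrightarrow> b \<in> I' \<Longrightarrow> ((\<lambda>e. B' e b i) \<longlongrightarrow> dB b i) F"
    and C: "\<And>b d. b \<in> I' \<Longrightarrow> d \<in> I' \<Longrightarrow> ((\<lambda>e. C e b d) \<longlongrightarrow> (if b = d then \<delta> else 0)) F"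
    and rhs1: "\<And>i. i \<in> I \<Longrightarrow> ((\<lambda>e. (\<Sum>j\<in>I. K e i j * w e j) + (\<Sum>b\<in>I'. B e i b * v e b)) \<longlongrightarrow> (\<Sum>j\<in>I. K0 i j * u j)) F"
    and rhs2: "\<And>b. b \<in> I' \<Longrightarrow> ((\<lambda>e. (\<Sum>j\<in>I. B' e b j * w e j) + (\<Sum>d\<in>I'. C e b d * v e d))
      \<longlongrightarrow> (\<Sum>j\<in>I. dB b j * u j) + \<delta> * v0 b) F"
  shows "i \<in> I \<Longrightarrow> ((\<lambda>e. w e i) \<longlongrightarrow> u i) F" and "b \<in> I' \<Longrightarrow> ((\<lambda>e. v e b) \<longlongrightarrow> v0 b) F"
proof -
  define A where "A e = case_sum (\<lambda>i. case_sum (K e i) (B e i)) (\<lambda>b. case_sum (B' e b) (C e b))" for e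
  define A0 where "A0 = case_sum (\<lambda>i. case_sum (K0 i) (\<lambda>b. 0)) (\<lambda>b. case_sum (dB b) (\<lambda>d. if b = d then \<delta> else 0))"
  \<comment> \<open>The lower left block is that of the inverse of a triangular block matrix:
    \<open>- dB L / \<delta>\<close>.\<close>
  define M where "M = case_sum (\<lambda>i. case_sum (L i) (\<lambda>b. 0))
    (\<lambda>b. case_sum (\<lambda>i. - (\<Sum>j\<in>I. dB b j * L j i) / \<delta>) (\<lambda>d. if b = d then 1 / \<delta> else 0))"
  have lim: "((\<lambda>e. case_sum (w e) (v e) m) \<longlongrightarrow> case_sum u v0 m) F" if "m \<in> I <+> I'" for m
  proof (rule perturbed_system_tendsto[where A=A and ?A0.0=A0 and L=M, OF _ _ _ _ that])
    show "finite (I <+> I')" using I I' by simp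
    show "((\<lambda>e. A e i j) \<longlongrightarrow> A0 i j) F" if "i \<in> I <+> I'" "j \<in> I <+> I'" for i j
      using that K B B' C by (auto simp: A_def A0_def)
    show "((\<lambda>e. \<Sum>j\<in>I <+> I'. A e i j * case_sum (w e) (v e) j) \<longlongrightarrow> (\<Sum>j\<in>I <+> I'. A0 i j * case_sum u v0 j)) F"
      if "i \<in> I <+> I'" for i
      using that rhs1 rhs2 I I'
      by (auto simp: A_def A0_def sum.Plus if_distrib[of "\<lambda>x. x * _"] cong: if_cong)
    show "(\<Sum>i\<in>I <+> I'. M m i * A0 i j) = (if m = j then 1 else 0)"
      if mj: "m \<in> I <+> I'" "j \<in> I <+> I'" for m j
    proof -
      have dB: "(\<Sum>i\<in>I. - (\<Sum>j\<in>I. dB b j * L j i) / \<delta> * K0 i j') = - dB b j' / \<delta>" if "j' \<in> I" for b j'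
      proof -
        have "(\<Sum>i\<in>I. (\<Sum>j\<in>I. dB b j * L j i) * K0 i j') = (\<Sum>j\<in>I. dB b j * (\<Sum>i\<in>I. L j i * K0 i j'))"
          unfolding sum_distrib_left sum_distrib_right by (subst sum.swap) (simp add: mult.assoc)
        also have "\<dots> = dB b j'"
          using inv that I by (simp add: if_distrib[of "\<lambda>x. _ * x"] cong: if_cong)
        finally show ?thesis
          by (simp add: sum_negf sum_divide_distrib[symmetric])
      qed
      have diagonal: "(\<Sum>b'\<in>I'. (if b = b' then 1 / \<delta> else 0) * g b') = g b / \<delta>" if "b \<in> I'" for b and g :: "'j \<Rightarrow> real"
        using that I' by (simp add: if_distrib[of "\<lambda>x. x * _"] cong: if_cong)
      consider (ll) i j' where "m = Inl i" "j = Inl j'" "i \<in> I" "j' \<in> I"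
        | (lr) i d where "m = Inl i" "j = Inr d" "i \<in> I" "d \<in> I'"
        | (rl) b j' where "m = Inr b" "j = Inl j'" "b \<in> I'" "j' \<in> I"
        | (rr) b d where "m = Inr b" "j = Inr d" "b \<in> I'" "d \<in> I'"
        using mj by blast
      then show ?thesis
      proof cases
        case ll
        then show ?thesis using inv I I' by (simp add: M_def A0_def sum.Plus)
      next
        case lr
        then show ?thesis using I I' by (simp add: M_def A0_def sum.Plus)
      next
        case rl
        then show ?thesis
          using I I' dB[of j' b] diagonal[of b "\<lambda>b. dB b j'"] by (simp add: M_def A0_def sum.Plus)
      next
        case rr
        then show ?thesis
          using I I' \<delta> diagonal[of b "\<lambda>b. if b = d then \<delta> else 0"] by (simp add: M_def A0_def sum.Plus)
      qed
    qed
  qed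
  show "((\<lambda>e. w e i) \<longlongrightarrow> u i) F" if "i \<in> I"
    using lim[OF InlI[OF that]] by simp
  show "((\<lambda>e. v e b) \<longlongrightarrow> v0 b) F" if "b \<in> I'"
    using lim[OF InrI[OF that]] by simp
qed

section \<open>Integrability and the expansion of the objective\<close>

lemma integrable_mult_bounded:
  fixes g v :: "real \<Rightarrow> real"
  assumes "integrable (lebesgue_on {0<..<l}) g" "v \<in> borel_measurable (lebesgue_on {0<..<l})"
    and "\<And>t. t \<in> {0<..<l} \<Longrightarrow> \<bar>v t\<bar> \<le> M"
  shows "integrable (lebesgue_on {0<..<l}) (\<lambda>t. g t * v t)"
proof (rule Bochner_Integration.integrable_bound)
  show "integrable (lebesgue_on {0<..<l}) (\<lambda>t. g t * M)"
    using assms(1) by simp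
  show "(\<lambda>t. g t * v t) \<in> borel_measurable (lebesgue_on {0<..<l})"
    using assms by (intro borel_measurable_times) auto
  show "AE t in lebesgue_on {0<..<l}. norm (g t * v t) \<le> norm (g t * M)"
  proof (rule AE_lebesgue_on_finite[where S="{}"])
    fix t assume "t \<in> {0<..<l} - {}"
    then have "\<bar>v t\<bar> \<le> \<bar>M\<bar>" using assms(3)[of t] by simp
    then show "norm (g t * v t) \<le> norm (g t * M)"
      by (simp add: abs_mult mult_left_mono)
  qed simp
qed

text \<open>The objective is quadratic, so the expansion has no remainder; boundedness of
  \<open>v\<close> makes the mixed and the quadratic term integrable.\<close>

lemma objective_perturbed:
  assumes w: "L2_on l (\<lambda>t. w t - uhat t)"
    and v: "v \<in> borel_measurable (lebesgue_on {0<..<l})" "\<And>t. t \<in> {0<..<l} \<Longrightarrow> \<bar>v t\<bar> \<le> M"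
  shows "objective l uhat (\<lambda>t. w t + e * v t) = objective l uhat w
    + 2 * e * (LINT t|lebesgue_on {0<..<l}. (w t - uhat t) * v t)
    + e\<^sup>2 * (LINT t|lebesgue_on {0<..<l}. v t * v t)"
proof -
  have 1: "integrable (lebesgue_on {0<..<l}) (\<lambda>t. (w t - uhat t)\<^sup>2)"
    using w by (simp add: L2_on_def)
  have 2: "integrable (lebesgue_on {0<..<l}) (\<lambda>t. (w t - uhat t) * v t)"
    by (rule integrable_mult_bounded[OF integrable_if_L2_on[OF w] v])
  have "integrable (lebesgue_on {0<..<l}) v"
    using v by (intro integrable_lebesgue_on_bounded[where S="{}"]) auto
  then have 3: "integrable (lebesgue_on {0<..<l}) (\<lambda>t. v t * v t)"
    by (rule integrable_mult_bounded[OF _ v])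
  have "(w t + e * v t - uhat t)\<^sup>2 = (w t - uhat t)\<^sup>2 + 2 * e * ((w t - uhat t) * v t) + e\<^sup>2 * (v t * v t)" for t
    by (simp add: power2_eq_square algebra_simps)
  then show ?thesis
    unfolding objective_def using 1 2 3 by simp
qed

lemma L2_on_bounded_diff:
  assumes w: "w \<in> borel_measurable (lebesgue_on {0<..<l})" "\<And>t. t \<in> {0<..<l} \<Longrightarrow> \<bar>w t\<bar> \<le> M" and g: "L2_on l g"
  shows "L2_on l (\<lambda>t. w t - g t)"
  unfolding L2_on_def
proof
  have g': "g \<in> borel_measurable (lebesgue_on {0<..<l})" using g by (simp add: L2_on_def)
  show 1: "(\<lambda>t. w t - g t) \<in> borel_measurable (lebesgue_on {0<..<l})"
    using w(1) g' by (rule borel_measurable_diff)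
  have "integrable (lebesgue_on {0<..<l}) w"
    using w by (intro integrable_lebesgue_on_bounded[where S="{}"]) auto
  then have "integrable (lebesgue_on {0<..<l}) (\<lambda>t. w t * w t)"
    by (rule integrable_mult_bounded[OF _ w])
  then have "integrable (lebesgue_on {0<..<l}) (\<lambda>t. w t * w t + (g t)\<^sup>2 - 2 * (g t * w t))"
    using integrable_mult_bounded[OF integrable_if_L2_on[OF g] w] g by (simp add: L2_on_def)
  then show "integrable (lebesgue_on {0<..<l}) (\<lambda>t. (w t - g t)\<^sup>2)"
    by (simp add: power2_eq_square algebra_simps)
qed

section \<open>Condensation of the block system\<close>

lemma index_mult_mat_vec_sum:
  assumes "A \<in> carrier_mat r m" "v \<in> carrier_vec m" "i < r"
  shows "(A *\<^sub>v v) $ i = (\<Sum>j<m. A $$ (i, j) * v $ j)"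
  using assms by (simp add: scalar_prod_def atLeast0LessThan)

text \<open>The congruence that replaces every enrichment by its difference from the combination of
  hats with coefficients \<open>h\<close>, on the trial and on the test side: \<open>w\<close>
  collects the hats split off from the trial functions, and the second row loses \<open>h\<close>
  times the first.\<close>

lemma condensed_system:
  fixes K :: "nat \<Rightarrow> nat \<Rightarrow> real" and h :: "nat \<Rightarrow> real"
  assumes sym: "\<And>i j. i < n \<Longrightarrow> j < n \<Longrightarrow> K i j = K j i"
    and row1: "\<And>i. i < n \<Longrightarrow> (\<Sum>j<n. K i j * s j) + (\<Sum>b<m. P i b * v b) = f i"
    and row2: "(\<Sum>j<n. P j b * s j) + (\<Sum>d<m. Q b d * v d) = g"
  defines "w \<equiv> \<lambda>j. s j + h j * (\<Sum>d<m. v d)"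
    and "B \<equiv> \<lambda>i b. P i b - (\<Sum>j<n. K i j * h j)"
  shows "i < n \<Longrightarrow> (\<Sum>j<n. K i j * w j) + (\<Sum>b<m. B i b * v b) = f i"
    and "(\<Sum>j<n. B j b * w j) + (\<Sum>d<m. (Q b d - (\<Sum>i<n. h i * P i d) - (\<Sum>i<n. h i * P i b)
      + (\<Sum>i<n. h i * (\<Sum>j<n. K i j * h j))) * v d) = g - (\<Sum>i<n. h i * f i)"
proof -
  define V where "V = (\<Sum>d<m. v d)"
  define k where "k i = (\<Sum>j<n. K i j * h j)" for i
  show eq1: "(\<Sum>j<n. K i j * w j) + (\<Sum>b<m. B i b * v b) = f i" if "i < n" for i
  proof -
    have "(\<Sum>j<n. K i j * w j) = (\<Sum>j<n. K i j * s j) + k i * V"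
      by (simp add: w_def k_def V_def[symmetric] distrib_left sum.distrib sum_distrib_right mult.assoc)
    moreover have "(\<Sum>b<m. B i b * v b) = (\<Sum>b<m. P i b * v b) - k i * V"
      by (simp add: B_def k_def[symmetric] V_def left_diff_distrib sum_subtractf sum_distrib_left)
    ultimately show ?thesis using row1[OF that] by simp
  qed
  \<comment> \<open>Symmetry of \<open>K\<close> turns \<open>K h\<close> paired with
    \<open>w\<close> into \<open>h\<close> paired with \<open>K w\<close>, into which the
    transformed first row can be inserted.\<close>
  have "(\<Sum>j<n. k j * w j) = (\<Sum>i<n. h i * (\<Sum>j<n. K i j * w j))"
    unfolding k_def sum_distrib_left sum_distrib_right
    by (subst sum.swap) (auto intro!: sum.cong simp: sym mult_ac)
  also have "\<dots> = (\<Sum>i<n. h i * (f i - (\<Sum>d<m. B i d * v d)))"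
    using eq1 by (intro sum.cong) (auto simp: eq_diff_eq)
  also have "\<dots> = (\<Sum>i<n. h i * f i) - (\<Sum>i<n. h i * ((\<Sum>d<m. P i d * v d) - k i * V))"
    by (simp add: B_def k_def[symmetric] V_def left_diff_distrib right_diff_distrib sum_subtractf sum_distrib_left)
  also have "\<dots> = (\<Sum>i<n. h i * f i) - (\<Sum>d<m. (\<Sum>i<n. h i * P i d) * v d) + (\<Sum>i<n. h i * k i) * V"
  proof -
    have "(\<Sum>i<n. h i * (\<Sum>d<m. P i d * v d)) = (\<Sum>d<m. (\<Sum>i<n. h i * P i d) * v d)"
      unfolding sum_distrib_left sum_distrib_right by (subst sum.swap) (simp add: mult.assoc)
    then show ?thesis
      by (simp add: right_diff_distrib sum_subtractf sum_distrib_right mult.assoc)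
  qed
  finally have kw: "(\<Sum>j<n. k j * w j)
    = (\<Sum>i<n. h i * f i) - (\<Sum>d<m. (\<Sum>i<n. h i * P i d) * v d) + (\<Sum>i<n. h i * k i) * V" .
  have "(\<Sum>j<n. B j b * w j) = (\<Sum>j<n. P j b * s j) + (\<Sum>i<n. h i * P i b) * V - (\<Sum>j<n. k j * w j)"
    by (simp add: B_def k_def[symmetric] left_diff_distrib sum_subtractf)
      (simp add: w_def V_def[symmetric] distrib_left sum.distrib sum_distrib_left mult_ac)
  moreover have "(\<Sum>d<m. (Q b d - (\<Sum>i<n. h i * P i d) - (\<Sum>i<n. h i * P i b)
      + (\<Sum>i<n. h i * k i)) * v d) = (\<Sum>d<m. Q b d * v d) - (\<Sum>d<m. (\<Sum>i<n. h i * P i d) * v d)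
      - (\<Sum>i<n. h i * P i b) * V + (\<Sum>i<n. h i * k i) * V"
    by (simp add: V_def left_diff_distrib distrib_right sum_subtractf sum.distrib sum_distrib_left)
  ultimately show "(\<Sum>j<n. B j b * w j) + (\<Sum>d<m. (Q b d - (\<Sum>i<n. h i * P i d) - (\<Sum>i<n. h i * P i b)
      + (\<Sum>i<n. h i * (\<Sum>j<n. K i j * h j))) * v d) = g - (\<Sum>i<n. h i * f i)"
    using row2 kw unfolding k_def[symmetric] by simp
qed

section \<open>The topological derivative\<close>

lemma right_differentiable_imp_tendsto:
  assumes "right_differentiable g"
  shows "(g \<longlongrightarrow> g 0) (at_right 0)"
proof -
  have "((\<lambda>e. g 0 + e * right_quotient g e) \<longlongrightarrow> g 0 + 0 * right_deriv g) (at_right 0)"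
    by (intro tendsto_intros tendsto_right_deriv assms)
  moreover have "\<forall>\<^sub>F e in at_right 0. g 0 + e * right_quotient g e = g e"
    using eventually_at_right_less[of 0] by eventually_elim (simp add: right_quotient_def)
  ultimately show ?thesis
    using Lim_transform_eventually by fastforce
qed

lemma has_bochner_integral_linear_combination:
  fixes g :: "'i \<Rightarrow> 'a \<Rightarrow> real"
  assumes "\<And>i. i \<in> I \<Longrightarrow> integrable M (g i)"
  shows "has_bochner_integral M (\<lambda>t. \<Sum>i\<in>I. a i * g i t) (\<Sum>i\<in>I. a i * (LINT t|M. g i t))"
  using assms by (intro has_bochner_integral_sum has_bochner_integral_mult_right has_bochner_integral_integrable)

locale enriched_solution = inclusion +
  fixes f uhat :: "real \<Rightarrow> real" and u p :: "real vec" and uS uE :: "real \<Rightarrow> real vec"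
  assumes conductivity: "0 < l1" "0 < l2"
    and data: "L2_on l f" "L2_on l uhat"
    and state: "u \<in> carrier_vec n" "KS l l1 l2 x n k 0 *\<^sub>v u = fS l f x n"
    and enriched:
      "\<And>\<epsilon>. 0 < \<epsilon> \<Longrightarrow> \<epsilon> < eps_bar x k \<Longrightarrow> uS \<epsilon> \<in> carrier_vec n"
      "\<And>\<epsilon>. 0 < \<epsilon> \<Longrightarrow> \<epsilon> < eps_bar x k \<Longrightarrow> uE \<epsilon> \<in> carrier_vec 2"
      "\<And>\<epsilon>. 0 < \<epsilon> \<Longrightarrow> \<epsilon> < eps_bar x k \<Longrightarrow>
         enriched_matrix l l1 l2 x n k \<epsilon> *\<^sub>v (uS \<epsilon> @\<^sub>v uE \<epsilon>) = fS l f x n @\<^sub>v fE l f x k \<epsilon>"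
    and adjoint: "p \<in> carrier_vec n"
      "transpose_mat (KS l l1 l2 x n k 0) *\<^sub>v p =
         (- 2) \<cdot>\<^sub>v (mass l n (NS x) n (NS x) *\<^sub>v u - load l uhat n (NS x))"
begin

abbreviation KSm :: "real \<Rightarrow> nat \<Rightarrow> nat \<Rightarrow> real" where
  "KSm e i j \<equiv> KS l l1 l2 x n k e $$ (i, j)"

definition dK :: "nat \<Rightarrow> nat \<Rightarrow> real" where
  "dK i j = right_deriv (\<lambda>e. KSm e i j)"

text \<open>The entries of \<open>dK\<^sup>S\<^sup>E - dK\<^sup>S H\<^sup>T\<close>, the matrix in
  \<open>S2\<close>; they are also the right derivatives of \<open>B\<close> at 0.\<close>

definition dB :: "nat \<Rightarrow> nat \<Rightarrow> real" where
  "dB i b = right_deriv (\<lambda>e. KSE l l1 l2 x n k e $$ (i, b)) - (\<Sum>j<n. dK i j * h j)"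

text \<open>The solution of the limit of the divided second row,
  \<open>dB\<^sup>T u + l2 J\<^sup>2 v0 = \<integral> f dN\<^sup>E\<close>. It is the limit of
  \<open>uE\<close>.\<close>

definition v0 :: "nat \<Rightarrow> real" where
  "v0 b = ((LINT t|lebesgue_on {0<..<l}. f t * dNE l c b t) - (\<Sum>j<n. dB j b * u $ j)) / (l2 * J\<^sup>2)"

text \<open>At \<open>\<epsilon> = 0\<close> both enrichments equal \<open>\<Sum>j<n. h j * NS x j\<close>, so \<open>w\<close> and not \<open>uS\<close> tends to \<open>u\<close>.\<close>

definition w :: "real \<Rightarrow> nat \<Rightarrow> real" where
  "w e j = uS e $ j + h j * (\<Sum>d<2. uE e $ d)"

definition rate :: "real \<Rightarrow> nat \<Rightarrow> real" where
  "rate e j = (w e j - u $ j) / e"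

text \<open>The negative of the limit of \<open>K\<^sub>0\<close> applied to
  \<open>rate\<close>.\<close>

definition residual :: "nat \<Rightarrow> real" where
  "residual i = (\<Sum>j<n. dK i j * u $ j) + (\<Sum>b<2. dB i b * v0 b)"

section \<open>Limits of the coefficients and of their rates\<close>

lemma eventually_small: "\<forall>\<^sub>F e in at_right 0. 0 < e \<and> e < eps_bar x k"
  using eventually_at_right_real[OF eps_bar_pos] by eventually_elim simp

lemma KS_quotient_tendsto:
  "i < n \<Longrightarrow> j < n \<Longrightarrow> (right_quotient (\<lambda>e. KSm e i j) \<longlongrightarrow> dK i j) (at_right 0)"
  unfolding dK_def by (intro tendsto_right_deriv right_differentiable_KS)

lemma KS_tendsto: "i < n \<Longrightarrow> j < n \<Longrightarrow> ((\<lambda>e. KSm e i j) \<longlongrightarrow> KSm 0 i j) (at_right 0)"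
  by (intro right_differentiable_imp_tendsto right_differentiable_KS)

text \<open>Since \<open>B\<close> vanishes at 0, \<open>B e i b / e\<close> is itself a difference
  quotient.\<close>

lemma B_quotient_tendsto:
  assumes i: "i < n" and b: "b < 2"
  shows "((\<lambda>e. B e i b / e) \<longlongrightarrow> dB i b) (at_right 0)"
proof -
  have "((\<lambda>e. right_quotient (\<lambda>e. KSE l l1 l2 x n k e $$ (i, b)) e
      - (\<Sum>j<n. right_quotient (\<lambda>e. KSm e i j) e * h j)) \<longlongrightarrow> dB i b) (at_right 0)"
    unfolding dB_def using i b
    by (intro tendsto_intros tendsto_right_deriv right_differentiable_KSE KS_quotient_tendsto) auto
  moreover have "right_quotient (\<lambda>e. KSE l l1 l2 x n k e $$ (i, b)) e
      - (\<Sum>j<n. right_quotient (\<lambda>e. KSm e i j) e * h j) = B e i b / e" for e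
  proof -
    have "B e i b / e = (B e i b - B 0 i b) / e"
      using B_0[OF i b] by simp
    also have "\<dots> = right_quotient (\<lambda>e. KSE l l1 l2 x n k e $$ (i, b)) e
      - (\<Sum>j<n. right_quotient (\<lambda>e. KSm e i j) e * h j)"
      by (simp add: B_def right_quotient_def diff_divide_distrib left_diff_distrib sum_subtractf sum_divide_distrib)
    finally show ?thesis by simp
  qed
  ultimately show ?thesis by simp
qed

lemma B_tendsto:
  assumes "i < n" "b < 2"
  shows "((\<lambda>e. B e i b) \<longlongrightarrow> 0) (at_right 0)"
proof -
  have "((\<lambda>e. e * (B e i b / e)) \<longlongrightarrow> 0 * dB i b) (at_right 0)"
    by (intro tendsto_intros B_quotient_tendsto assms)
  moreover have "\<forall>\<^sub>F e in at_right 0. e * (B e i b / e) = B e i b"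
    using eventually_small by eventually_elim simp
  ultimately show ?thesis
    using Lim_transform_eventually by fastforce
qed

lemma state_row: "i < n \<Longrightarrow> (\<Sum>j<n. KSm 0 i j * u $ j) = fS l f x n $ i"
  unfolding state(2)[symmetric]
  by (rule index_mult_mat_vec_sum[OF _ state(1), symmetric]) (simp_all add: KS_def stiffness_def)

text \<open>\<open>h\<close> times the hat load is the load of the unperturbed enrichment, so
  \<open>f\<close> is tested with the increment of the enrichment. The factor \<open>e\<close> is
  the one by which the second row is divided.\<close>

lemma NE_load_difference:
  assumes e: "0 < e" "e < eps_bar x k" and b: "b < 2"
  shows "fE l f x k e $ b - (\<Sum>i<n. h i * fS l f x n $ i)
    = e * (LINT t|lebesgue_on {0<..<l}. f t * right_quotient (\<lambda>e. NE l c e b t) e)"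
proof -
  have f: "integrable (lebesgue_on {0<..<l}) f"
    using data integrable_if_L2_on by blast
  have int: "integrable (lebesgue_on {0<..<l}) (\<lambda>t. f t * g t)" if "piecewise_diff l g" for g
  proof -
    have g: "continuous_on {0..l} g" using that piecewise_diff_def by blast
    have "bounded (g ` {0..l})"
      by (rule compact_imp_bounded[OF compact_continuous_image[OF g]]) simp
    then obtain M where "\<forall>t\<in>{0..l}. \<bar>g t\<bar> \<le> M"
      by (auto simp: bounded_iff)
    then show ?thesis
      by (intro integrable_mult_bounded[OF f measurable_lebesgue_on_continuous[OF g], of M]) auto
  qed
  have "(\<Sum>i<n. h i * fS l f x n $ i) = (\<Sum>i<n. (LINT t|lebesgue_on {0<..<l}. h i * (f t * NS x i t)))"
    by (simp add: fS_def load_def)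
  also have "\<dots> = (LINT t|lebesgue_on {0<..<l}. (\<Sum>i<n. h i * (f t * NS x i t)))"
    by (intro Bochner_Integration.integral_sum[symmetric] integrable_mult_right int piecewise_diff_NS) auto
  also have "\<dots> = (LINT t|lebesgue_on {0<..<l}. f t * NE l c 0 b t)"
  proof (rule Bochner_Integration.integral_cong[OF refl])
    fix t assume "t \<in> space (lebesgue_on {0<..<l})"
    then have "(\<Sum>i<n. h i * NS x i t) = NE l c 0 b t"
      using sum_h_NS[of t] by (simp add: NE_eq_enrichment)
    then show "(\<Sum>i<n. h i * (f t * NS x i t)) = f t * NE l c 0 b t"
      by (simp add: sum_distrib_left[symmetric] mult.left_commute[of "h _"])
  qed
  finally have "fE l f x k e $ b - (\<Sum>i<n. h i * fS l f x n $ i)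
      = (LINT t|lebesgue_on {0<..<l}. f t * NE l c e b t - f t * NE l c 0 b t)"
    using b e eps_bar_pos
    by (simp add: fE_def load_def c_def[symmetric] int piecewise_diff_NE)
  also have "\<dots> = (LINT t|lebesgue_on {0<..<l}. e * (f t * right_quotient (\<lambda>e. NE l c e b t) e))"
    by (intro Bochner_Integration.integral_cong refl) (use e in \<open>simp add: right_quotient_def field_simps\<close>)
  finally show ?thesis by simp
qed

lemma enriched_rows:
  assumes e: "0 < e" "e < eps_bar x k"
  shows "i < n \<Longrightarrow> (\<Sum>j<n. KSm e i j * w e j) + (\<Sum>b<2. B e i b * uE e $ b) = fS l f x n $ i"
    and "b < 2 \<Longrightarrow> (\<Sum>j<n. B e j b / e * w e j) + (\<Sum>d<2. C e b d / e * uE e $ d)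
      = (LINT t|lebesgue_on {0<..<l}. f t * right_quotient (\<lambda>e. NE l c e b t) e)"
proof -
  have KS: "KS l l1 l2 x n k e \<in> carrier_mat n n" and KSE: "KSE l l1 l2 x n k e \<in> carrier_mat n 2"
    and KE: "KE l l1 l2 x k e \<in> carrier_mat 2 2"
    by (auto simp: KS_def KSE_def KE_def stiffness_def)
  have fS: "fS l f x n \<in> carrier_vec n"
    by (simp add: fS_def load_def)
  have "enriched_matrix l l1 l2 x n k e *\<^sub>v (uS e @\<^sub>v uE e)
      = (KS l l1 l2 x n k e *\<^sub>v uS e + KSE l l1 l2 x n k e *\<^sub>v uE e)
        @\<^sub>v (transpose_mat (KSE l l1 l2 x n k e) *\<^sub>v uS e + KE l l1 l2 x k e *\<^sub>v uE e)"
    unfolding enriched_matrix_def using KS KSE KE enriched(1,2)[OF e]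
    by (intro four_block_mat_mult_vec) auto
  then have "KS l l1 l2 x n k e *\<^sub>v uS e + KSE l l1 l2 x n k e *\<^sub>v uE e = fS l f x n \<and>
      transpose_mat (KSE l l1 l2 x n k e) *\<^sub>v uS e + KE l l1 l2 x k e *\<^sub>v uE e = fE l f x k e"
    using enriched(3)[OF e] append_vec_eq[OF _ fS, of "KS l l1 l2 x n k e *\<^sub>v uS e + KSE l l1 l2 x n k e *\<^sub>v uE e"]
      KS KSE enriched(1,2)[OF e] by (metis add_carrier_vec mult_mat_vec_carrier)
  then have eq1: "(KS l l1 l2 x n k e *\<^sub>v uS e + KSE l l1 l2 x n k e *\<^sub>v uE e) $ i = fS l f x n $ i"
    and eq2: "(transpose_mat (KSE l l1 l2 x n k e) *\<^sub>v uS e + KE l l1 l2 x k e *\<^sub>v uE e) $ b = fE l f x k e $ b" for i b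
    by auto
  have row1: "(\<Sum>j<n. KSm e i j * uS e $ j) + (\<Sum>b<2. KSE l l1 l2 x n k e $$ (i, b) * uE e $ b) = fS l f x n $ i"
    if "i < n" for i
    using eq1[of i] that KS KSE enriched(1,2)[OF e]
    by (simp add: index_mult_mat_vec_sum[OF KS] index_mult_mat_vec_sum[OF KSE] del: index_mult_mat_vec)
  have row2: "(\<Sum>j<n. KSE l l1 l2 x n k e $$ (j, b) * uS e $ j) + (\<Sum>d<2. KE l l1 l2 x k e $$ (b, d) * uE e $ d) = fE l f x k e $ b"
    if "b < 2" for b
  proof -
    have T: "transpose_mat (KSE l l1 l2 x n k e) \<in> carrier_mat 2 n" using KSE by simp
    have "(\<Sum>j<n. KSE l l1 l2 x n k e $$ (j, b) * uS e $ j)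
        = (\<Sum>j<n. transpose_mat (KSE l l1 l2 x n k e) $$ (b, j) * uS e $ j)"
      using KSE that by (intro sum.cong) auto
    then show ?thesis
      using eq2[of b] that KE T enriched(1,2)[OF e]
      by (simp add: index_mult_mat_vec_sum[OF T] index_mult_mat_vec_sum[OF KE] del: index_mult_mat_vec)
  qed
  have sym: "KSm e i j = KSm e j i" if "i < n" "j < n" for i j
    using that by (simp add: KS_entry a_commute)
  show "(\<Sum>j<n. KSm e i j * w e j) + (\<Sum>b<2. B e i b * uE e $ b) = fS l f x n $ i" if "i < n"
    unfolding B_def w_def using that
    by (intro condensed_system(1)[where K="KSm e" and s="\<lambda>j. uS e $ j" and v="\<lambda>b. uE e $ b" and m=2
      and P="\<lambda>i b. KSE l l1 l2 x n k e $$ (i, b)" and Q="\<lambda>b d. KE l l1 l2 x k e $$ (b, d)" and h=h and b=0, OF sym row1 row2]) auto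
  show "(\<Sum>j<n. B e j b / e * w e j) + (\<Sum>d<2. C e b d / e * uE e $ d)
      = (LINT t|lebesgue_on {0<..<l}. f t * right_quotient (\<lambda>e. NE l c e b t) e)" if b: "b < 2"
  proof -
    have "(\<Sum>j<n. B e j b * w e j) + (\<Sum>d<2. C e b d * uE e $ d)
        = fE l f x k e $ b - (\<Sum>i<n. h i * fS l f x n $ i)"
      unfolding B_def w_def C_def 
      by (intro condensed_system(2)[where K="KSm e" and s="\<lambda>j. uS e $ j" and v="\<lambda>b. uE e $ b" and m=2
      and P="\<lambda>i b. KSE l l1 l2 x n k e $$ (i, b)" and Q="\<lambda>b d. KE l l1 l2 x k e $$ (b, d)" and h=h, OF sym row1 row2[OF b]]) auto
    also have "\<dots> = e * (LINT t|lebesgue_on {0<..<l}. f t * right_quotient (\<lambda>e. NE l c e b t) e)"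
      by (rule NE_load_difference[OF e b])
    finally show ?thesis
      using e by (simp add: sum_divide_distrib[symmetric] add_divide_distrib[symmetric] field_simps)
  qed
qed

lemma coefficients_tendsto:
  shows "j < n \<Longrightarrow> ((\<lambda>e. w e j) \<longlongrightarrow> u $ j) (at_right 0)"
    and "b < 2 \<Longrightarrow> ((\<lambda>e. uE e $ b) \<longlongrightarrow> v0 b) (at_right 0)"
proof -
  have "l2 * J\<^sup>2 \<noteq> 0"
    using conductivity J_pos by simp
  have inv: "(\<Sum>i<n. enrichment l (x (Suc m)) (x (Suc i)) * ((x (Suc m) * (l - x (Suc m))) / (l1 * l)) * KSm 0 i j)
      = (if m = j then 1 else 0)" if "m \<in> {..<n}" "j \<in> {..<n}" for m j
    using that stiffness_left_inverse[of m j] conductivity by simp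
  have rhs1: "((\<lambda>e. (\<Sum>j<n. KSm e i j * w e j) + (\<Sum>b<2. B e i b * uE e $ b))
      \<longlongrightarrow> (\<Sum>j<n. KSm 0 i j * u $ j)) (at_right 0)" if i: "i \<in> {..<n}" for i
  \<comment> \<open>The hat load does not depend on \<open>e\<close>, so for small \<open>e\<close>
    the perturbed row equals the unperturbed one exactly.\<close>
  proof (rule tendsto_eventually)
    show "\<forall>\<^sub>F e in at_right 0. (\<Sum>j<n. KSm e i j * w e j) + (\<Sum>b<2. B e i b * uE e $ b)
        = (\<Sum>j<n. KSm 0 i j * u $ j)"
      using eventually_small by eventually_elim (use i enriched_rows(1) state_row in auto)
  qed
  have rhs2: "((\<lambda>e. (\<Sum>j<n. B e j b / e * w e j) + (\<Sum>d<2. C e b d / e * uE e $ d))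
      \<longlongrightarrow> (\<Sum>j<n. dB j b * u $ j) + l2 * J\<^sup>2 * v0 b) (at_right 0)" if b: "b \<in> {..<2}" for b
  proof (rule Lim_transform_eventually)
    \<comment> \<open>The choice of \<open>v0\<close> brings the limit of the load into the form of
      the lower row of the limit system.\<close>
    have "(\<Sum>j<n. dB j b * u $ j) + l2 * J\<^sup>2 * v0 b = (LINT t|lebesgue_on {0<..<l}. f t * dNE l c b t)"
      using \<open>l2 * J\<^sup>2 \<noteq> 0\<close> by (simp add: v0_def)
    then show "((\<lambda>e. LINT t|lebesgue_on {0<..<l}. f t * right_quotient (\<lambda>e. NE l c e b t) e)
        \<longlongrightarrow> (\<Sum>j<n. dB j b * u $ j) + l2 * J\<^sup>2 * v0 b) (at_right 0)"
      using tendsto_LINT_right_quotient_NE[OF c_interior integrable_if_L2_on[OF data(1)]] by simp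
    show "\<forall>\<^sub>F e in at_right 0. (LINT t|lebesgue_on {0<..<l}. f t * right_quotient (\<lambda>e. NE l c e b t) e)
        = (\<Sum>j<n. B e j b / e * w e j) + (\<Sum>d<2. C e b d / e * uE e $ d)"
      using eventually_small by eventually_elim (use b enriched_rows(2) in auto)
  qed
  note limits = perturbed_block_system_tendsto[where F="at_right 0" and K=KSm and B=B
      and B'="\<lambda>e b j. B e j b / e" and dB="\<lambda>b j. dB j b" and C="\<lambda>e b d. C e b d / e"
      and w=w and u="\<lambda>j. u $ j" and v="\<lambda>e b. uE e $ b" and ?v0.0=v0
      and I="{..<n}" and I'="{..<2}", OF finite_lessThan finite_lessThan \<open>l2 * J\<^sup>2 \<noteq> 0\<close> inv _ _ _ _ rhs1 rhs2]
  show "((\<lambda>e. w e j) \<longlongrightarrow> u $ j) (at_right 0)" if "j < n"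
    by (rule limits(1)) (use that KS_tendsto B_tendsto B_quotient_tendsto C_quotient_tendsto in auto)
  show "((\<lambda>e. uE e $ b) \<longlongrightarrow> v0 b) (at_right 0)" if "b < 2"
    by (rule limits(2)) (use that KS_tendsto B_tendsto B_quotient_tendsto C_quotient_tendsto in auto)
qed

text \<open>\<open>K\<^sub>e w + B v\<close> and \<open>K\<^sub>0 u\<close> are the same load.
  Subtracting \<open>K\<^sub>0 w\<close> and dividing by \<open>e\<close> expresses
  \<open>K\<^sub>0\<close> applied to the rate through difference quotients and coefficients with
  known limits.\<close>

lemma stiffness_rate_tendsto:
  assumes i: "i < n"
  shows "((\<lambda>e. \<Sum>j<n. KSm 0 i j * rate e j) \<longlongrightarrow> - residual i) (at_right 0)"
proof (rule Lim_transform_eventually)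
  show "((\<lambda>e. - ((\<Sum>j<n. right_quotient (\<lambda>e. KSm e i j) e * w e j) + (\<Sum>b<2. B e i b / e * uE e $ b)))
      \<longlongrightarrow> - residual i) (at_right 0)"
    unfolding residual_def using i
    by (intro tendsto_intros KS_quotient_tendsto B_quotient_tendsto coefficients_tendsto) auto
  show "\<forall>\<^sub>F e in at_right 0. - ((\<Sum>j<n. right_quotient (\<lambda>e. KSm e i j) e * w e j) + (\<Sum>b<2. B e i b / e * uE e $ b))
      = (\<Sum>j<n. KSm 0 i j * rate e j)"
    using eventually_small
  proof eventually_elim
    case (elim e)
    have "(\<Sum>j<n. KSm 0 i j * rate e j) = ((\<Sum>j<n. KSm 0 i j * w e j) - (\<Sum>j<n. KSm 0 i j * u $ j)) / e"
      by (simp add: rate_def right_diff_distrib sum_subtractf diff_divide_distrib sum_divide_distrib)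
    then have "e * (\<Sum>j<n. KSm 0 i j * rate e j) = (\<Sum>j<n. KSm 0 i j * w e j) - (\<Sum>j<n. KSm 0 i j * u $ j)"
      using elim by simp
    moreover have "e * (\<Sum>j<n. right_quotient (\<lambda>e. KSm e i j) e * w e j)
        = (\<Sum>j<n. KSm e i j * w e j) - (\<Sum>j<n. KSm 0 i j * w e j)"
      using elim by (simp add: right_quotient_def sum_distrib_left left_diff_distrib sum_subtractf)
    moreover have "e * (\<Sum>b<2. B e i b / e * uE e $ b) = (\<Sum>b<2. B e i b * uE e $ b)"
      using elim by (simp add: sum_distrib_left)
    moreover have "(\<Sum>j<n. KSm e i j * w e j) + (\<Sum>b<2. B e i b * uE e $ b) = (\<Sum>j<n. KSm 0 i j * u $ j)"
      using elim enriched_rows(1) state_row i by simp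
    ultimately have "e * (\<Sum>j<n. right_quotient (\<lambda>e. KSm e i j) e * w e j)
        + e * (\<Sum>b<2. B e i b / e * uE e $ b) + e * (\<Sum>j<n. KSm 0 i j * rate e j) = 0"
      by linarith
    then have "(\<Sum>j<n. right_quotient (\<lambda>e. KSm e i j) e * w e j)
        + (\<Sum>b<2. B e i b / e * uE e $ b) + (\<Sum>j<n. KSm 0 i j * rate e j) = 0"
      using elim unfolding distrib_left[symmetric] by simp
    then show ?case by linarith
  qed
qed

text \<open>The explicit left inverse recovers the rate from the preceding limit. Existence of the
  limit controls the quadratic term of the objective; its contribution to the derivative is
  evaluated through the adjoint.\<close>

lemma rate_convergent:
  assumes m: "m < n"
  shows "\<exists>y. ((\<lambda>e. rate e m) \<longlongrightarrow> y) (at_right 0)"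
proof -
  define L where "L i = enrichment l (x (Suc m)) (x (Suc i)) * ((x (Suc m) * (l - x (Suc m))) / (l1 * l))" for i
  have "rate e m = (\<Sum>i<n. L i * (\<Sum>j<n. KSm 0 i j * rate e j))" for e
  proof -
    have "rate e m = (\<Sum>j<n. (\<Sum>i<n. L i * KSm 0 i j) * rate e j)"
      using stiffness_left_inverse[OF m] conductivity m
      by (simp add: L_def if_distrib[of "\<lambda>x. x * _"] cong: if_cong)
    also have "\<dots> = (\<Sum>i<n. L i * (\<Sum>j<n. KSm 0 i j * rate e j))"
      unfolding sum_distrib_left sum_distrib_right by (subst sum.swap) (simp add: mult.assoc)
    finally show ?thesis .
  qed
  moreover have "((\<lambda>e. \<Sum>i<n. L i * (\<Sum>j<n. KSm 0 i j * rate e j)) \<longlongrightarrow> (\<Sum>i<n. L i * - residual i)) (at_right 0)"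
    by (intro tendsto_intros stiffness_rate_tendsto) auto
  ultimately show ?thesis by auto
qed

section \<open>The claimed sum in coordinates\<close>

definition shape_weight :: "nat \<Rightarrow> real" where
  "shape_weight b = (\<Sum>i<n. u $ i * (LINT t|lebesgue_on {0<..<l}. NS x i t * dNE l c b t))
    - (LINT t|lebesgue_on {0<..<l}. uhat t * dNE l c b t)"

text \<open>The matrix in \<open>S2\<close> has the entries \<open>dB\<close>, so \<open>S0\<close>
  and \<open>S2\<close> merge into half the pairing of \<open>p\<close> with
  \<open>residual\<close>. \<open>S1\<close> contributes the pairing of \<open>v0\<close> with
  \<open>shape_weight\<close>.\<close>

lemma topological_derivative_eq:
  "S0 l l1 l2 x n k u p + S1 l uhat x n k u (vec 2 v0) + S2 l l1 l2 x n k p (vec 2 v0)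
    = 1 / 2 * (\<Sum>i<n. p $ i * residual i) + (\<Sum>b<2. v0 b * shape_weight b)"
proof -
  have "S0 l l1 l2 x n k u p = 1 / 2 * (\<Sum>i<n. p $ i * (\<Sum>j<n. dK i j * u $ j))"
  proof -
    have K: "dKS l l1 l2 x n k \<in> carrier_mat n n" by (simp add: dKS_def)
    have "p \<bullet> (dKS l l1 l2 x n k *\<^sub>v u) = (\<Sum>i<n. p $ i * (dKS l l1 l2 x n k *\<^sub>v u) $ i)"
      using K by (simp add: scalar_prod_def atLeast0LessThan del: index_mult_mat_vec)
    also have "\<dots> = (\<Sum>i<n. p $ i * (\<Sum>j<n. dK i j * u $ j))"
      by (intro sum.cong refl, subst index_mult_mat_vec_sum[OF K state(1)]) (auto simp: dKS_def dK_def)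
    finally show ?thesis by (simp add: S0_def)
  qed
  moreover have "S1 l uhat x n k u (vec 2 v0) = (\<Sum>b<2. v0 b * shape_weight b)"
  proof -
    have T: "transpose_mat (dMSE l x n k) \<in> carrier_mat 2 n" by (simp add: dMSE_def mass_def)
    have m: "dmE l uhat x k \<in> carrier_vec 2" by (simp add: dmE_def load_def)
    have "S1 l uhat x n k u (vec 2 v0)
        = (\<Sum>b<2. ((transpose_mat (dMSE l x n k) *\<^sub>v u) $ b - dmE l uhat x k $ b) * v0 b)"
      using T m by (simp add: S1_def scalar_prod_def atLeast0LessThan del: index_mult_mat_vec)
    also have "\<dots> = (\<Sum>b<2. v0 b * shape_weight b)"
      by (intro sum.cong refl, subst index_mult_mat_vec_sum[OF T state(1)])
        (auto simp: dMSE_def mass_def dmE_def load_def shape_weight_def c_def mult.commute)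
    finally show ?thesis .
  qed
  moreover have "S2 l l1 l2 x n k p (vec 2 v0) = 1 / 2 * (\<Sum>i<n. p $ i * (\<Sum>b<2. dB i b * v0 b))"
  proof -
    let ?M = "dKSE l l1 l2 x n k - dKS l l1 l2 x n k * transpose_mat (H_mat l x n k)"
    have M: "?M \<in> carrier_mat n 2"
      unfolding dKSE_def dKS_def H_mat_def by (intro minus_carrier_mat mult_carrier_mat[of _ n n]) auto
    have entry: "?M $$ (i, b) = dB i b" if "i < n" "b < 2" for i b
      using that by (simp add: dKSE_def dKS_def H_mat_def dB_def dK_def h_def c_def NE_eq_enrichment
          scalar_prod_def atLeast0LessThan)
    have "p \<bullet> (?M *\<^sub>v vec 2 v0) = (\<Sum>i<n. p $ i * (?M *\<^sub>v vec 2 v0) $ i)"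
      using M by (simp add: scalar_prod_def atLeast0LessThan dKS_def del: index_mult_mat_vec)
    also have "\<dots> = (\<Sum>i<n. p $ i * (\<Sum>b<2. dB i b * v0 b))"
      by (intro sum.cong refl, subst index_mult_mat_vec_sum[OF M vec_carrier]) (auto simp: entry simp del: index_minus_mat index_mult_mat)
    finally show ?thesis by (simp add: S2_def)
  qed
  ultimately show ?thesis
    by (simp add: residual_def distrib_left sum.distrib)
qed

section \<open>The misfit, the adjoint and the difference quotient of the state\<close>

definition misfit :: "real \<Rightarrow> real" where
  "misfit t = uh x n u t - uhat t"

lemma NS_bounded:
  obtains M where "\<And>j t. j < n \<Longrightarrow> t \<in> {0..l} \<Longrightarrow> \<bar>NS x j t\<bar> \<le> M j"
proof -
  have "\<exists>M. \<forall>t\<in>{0..l}. \<bar>NS x j t\<bar> \<le> M" if "j < n" for j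
  proof -
    have "continuous_on {0..l} (NS x j)" using piecewise_diff_NS[OF that] piecewise_diff_def by blast
    then have "bounded (NS x j ` {0..l})"
      by (intro compact_imp_bounded compact_continuous_image) simp_all
    then show ?thesis
      by (auto simp: bounded_iff)
  qed
  then show ?thesis using that by metis
qed

lemma NS_measurable: "j < n \<Longrightarrow> NS x j \<in> borel_measurable (lebesgue_on {0<..<l})"
  using piecewise_diff_NS measurable_lebesgue_on_continuous piecewise_diff_def by blast

lemma L2_on_misfit: "L2_on l misfit"
proof -
  obtain M where M: "\<And>j t. j < n \<Longrightarrow> t \<in> {0..l} \<Longrightarrow> \<bar>NS x j t\<bar> \<le> M j"
    using NS_bounded by blast
  have bound: "\<bar>uh x n u t\<bar> \<le> (\<Sum>j<n. \<bar>u $ j\<bar> * M j)" if "t \<in> {0<..<l}" for t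
    unfolding uh_def fem_fun_def
    by (rule order_trans[OF sum_abs]) (use that in \<open>auto simp: abs_mult intro!: sum_mono mult_left_mono M\<close>)
  have "uh x n u \<in> borel_measurable (lebesgue_on {0<..<l})"
    unfolding uh_def fem_fun_def by (intro borel_measurable_sum borel_measurable_times NS_measurable) auto
  from L2_on_bounded_diff[OF this bound data(2)] show ?thesis
    unfolding misfit_def .
qed

text \<open>The difference quotient of the enriched state, split into the change of the hat
  coefficients and the change of shape of the enrichments.\<close>

definition variation :: "real \<Rightarrow> real \<Rightarrow> real" where
  "variation e t = (\<Sum>j<n. rate e j * NS x j t) + (\<Sum>b<2. uE e $ b * right_quotient (\<lambda>e. NE l c e b t) e)"

text \<open>Adding and subtracting the unperturbed enrichment, which is the combination of hats with
  coefficients \<open>h\<close>, turns \<open>uS\<close> into \<open>w\<close> and \<open>NE\<close>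
  into its increment.\<close>

lemma uh_enriched_eq:
  assumes e: "e \<noteq> 0" and t: "t \<in> {0<..<l}"
  shows "uh_enriched l x n k e (uS e) (uE e) t = uh x n u t + e * variation e t"
proof -
  have "(\<Sum>j<n. rate e j * NS x j t) = ((\<Sum>j<n. w e j * NS x j t) - uh x n u t) / e"
    by (simp add: rate_def uh_def fem_fun_def left_diff_distrib diff_divide_distrib sum_subtractf sum_divide_distrib)
  moreover have "(\<Sum>b<2. uE e $ b * right_quotient (\<lambda>e. NE l c e b t) e)
      = (\<Sum>b<2. uE e $ b * (NE l c e b t - NE l c 0 b t)) / e"
    by (simp add: right_quotient_def sum_divide_distrib)
  ultimately have "uh x n u t + e * variation e t
      = (\<Sum>j<n. w e j * NS x j t) + (\<Sum>b<2. uE e $ b * (NE l c e b t - NE l c 0 b t))"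
    using e by (simp only: variation_def distrib_left) simp
  also have "(\<Sum>j<n. w e j * NS x j t) = (\<Sum>j<n. uS e $ j * NS x j t) + (\<Sum>d<2. uE e $ d) * (\<Sum>j<n. h j * NS x j t)"
  proof -
    define E where "E = (\<Sum>d<2. uE e $ d)"
    show ?thesis
      unfolding w_def E_def[symmetric] by (simp add: algebra_simps sum.distrib sum_distrib_left)
  qed
  also have "(\<Sum>b<2. uE e $ b * (NE l c e b t - NE l c 0 b t))
      = (\<Sum>b<2. uE e $ b * NE l c e b t) - (\<Sum>d<2. uE e $ d) * (\<Sum>j<n. h j * NS x j t)"
  proof -
    have "NE l c 0 b = enrichment l c" for b by (simp add: NE_eq_enrichment)
    then show ?thesis
      using sum_h_NS[OF t] by (simp add: right_diff_distrib sum_subtractf sum_distrib_right)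
  qed
  finally show ?thesis
    by (simp add: uh_enriched_def fem_fun_def c_def)
qed

lemma integrable_misfit_NS: "j < n \<Longrightarrow> integrable (lebesgue_on {0<..<l}) (\<lambda>t. misfit t * NS x j t)"
  using NS_bounded NS_measurable integrable_if_L2_on[OF L2_on_misfit]
  by (metis integrable_mult_bounded greaterThanLessThan_subseteq_atLeastAtMost_iff order_refl subsetD)

text \<open>This is entry \<open>j\<close> of the adjoint equation: \<open>M u - m\<close> consists
  of the integrals of the misfit against the hat functions.\<close>

lemma misfit_NS:
  assumes j: "j < n"
  shows "(\<Sum>i<n. p $ i * KSm 0 i j) = - 2 * (LINT t|lebesgue_on {0<..<l}. misfit t * NS x j t)"
proof -
  have T: "transpose_mat (KS l l1 l2 x n k 0) \<in> carrier_mat n n"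
    by (simp add: KS_def stiffness_def)
  have M: "mass l n (NS x) n (NS x) \<in> carrier_mat n n"
    by (simp add: mass_def)
  have "(\<Sum>i<n. p $ i * KSm 0 i j) = (transpose_mat (KS l l1 l2 x n k 0) *\<^sub>v p) $ j"
    unfolding index_mult_mat_vec_sum[OF T adjoint(1) j]
    using T j by (intro sum.cong) (auto simp: mult.commute)
  also have "\<dots> = - 2 * ((mass l n (NS x) n (NS x) *\<^sub>v u) $ j - load l uhat n (NS x) $ j)"
    unfolding adjoint(2) using M j by (simp add: load_def del: index_mult_mat_vec)
  also have "(mass l n (NS x) n (NS x) *\<^sub>v u) $ j - load l uhat n (NS x) $ j
      = (\<Sum>i<n. (LINT t|lebesgue_on {0<..<l}. NS x j t * NS x i t) * u $ i) - (LINT t|lebesgue_on {0<..<l}. uhat t * NS x j t)"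
    unfolding index_mult_mat_vec_sum[OF M state(1) j] using j by (simp add: mass_def load_def)
  also have "\<dots> = (LINT t|lebesgue_on {0<..<l}. misfit t * NS x j t)"
  proof -
    obtain N where N: "\<And>j t. j < n \<Longrightarrow> t \<in> {0..l} \<Longrightarrow> \<bar>NS x j t\<bar> \<le> N j"
      using NS_bounded by blast
    have "integrable (lebesgue_on {0<..<l}) (NS x i)" if "i < n" for i
      using N[OF that] that by (intro integrable_lebesgue_on_bounded[where S="{}" and C="N i"] NS_measurable) auto
    then have 1: "integrable (lebesgue_on {0<..<l}) (\<lambda>t. NS x i t * NS x j t)" if "i < n" for i
      using that N[OF j] by (intro integrable_mult_bounded[where M="N j"] NS_measurable j) auto
    have 2: "integrable (lebesgue_on {0<..<l}) (\<lambda>t. uhat t * NS x j t)"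
      using N[OF j] by (intro integrable_mult_bounded[where M="N j"] NS_measurable j integrable_if_L2_on data) auto
    have "misfit t * NS x j t = (\<Sum>i<n. u $ i * (NS x i t * NS x j t)) - uhat t * NS x j t" for t
      by (simp add: misfit_def uh_def fem_fun_def left_diff_distrib sum_distrib_right mult.assoc)
    moreover have "has_bochner_integral (lebesgue_on {0<..<l})
        (\<lambda>t. (\<Sum>i<n. u $ i * (NS x i t * NS x j t)) - uhat t * NS x j t)
        ((\<Sum>i<n. u $ i * (LINT t|lebesgue_on {0<..<l}. NS x i t * NS x j t)) - (LINT t|lebesgue_on {0<..<l}. uhat t * NS x j t))"
      by (intro has_bochner_integral_diff has_bochner_integral_linear_combination has_bochner_integral_integrable 1 2) simp
    ultimately show ?thesis
      by (simp add: has_bochner_integral_iff mult.commute)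
  qed
  finally show ?thesis .
qed

text \<open>The adjoint replaces the integrals of the misfit by \<open>- 1 / 2\<close> times
  \<open>p\<close> paired with \<open>K\<^sub>0\<close>, and \<open>K\<^sub>0\<close> applied to the
  rate tends to \<open>- residual\<close>. The two signs cancel, which fixes the signs of
  \<open>S0\<close> and \<open>S2\<close>.\<close>

lemma misfit_rate_tendsto:
  "((\<lambda>e. \<Sum>j<n. rate e j * (LINT t|lebesgue_on {0<..<l}. misfit t * NS x j t))
    \<longlongrightarrow> 1 / 2 * (\<Sum>i<n. p $ i * residual i)) (at_right 0)"
proof -
  have lim: "((\<lambda>e. - 1 / 2 * (\<Sum>i<n. p $ i * (\<Sum>j<n. KSm 0 i j * rate e j)))
      \<longlongrightarrow> - 1 / 2 * (\<Sum>i<n. p $ i * - residual i)) (at_right 0)"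
    by (intro tendsto_intros stiffness_rate_tendsto) auto
  have limit: "- 1 / 2 * (\<Sum>i<n. p $ i * - residual i) = 1 / 2 * (\<Sum>i<n. p $ i * residual i)"
    by (simp add: sum_negf)
  have eq: "- 1 / 2 * (\<Sum>i<n. p $ i * (\<Sum>j<n. KSm 0 i j * rate e j))
      = (\<Sum>j<n. rate e j * (LINT t|lebesgue_on {0<..<l}. misfit t * NS x j t))" for e
  proof -
    have "(\<Sum>i<n. p $ i * (\<Sum>j<n. KSm 0 i j * rate e j)) = (\<Sum>j<n. (\<Sum>i<n. p $ i * KSm 0 i j) * rate e j)"
      unfolding sum_distrib_left sum_distrib_right by (subst sum.swap) (simp add: mult.assoc)
    also have "\<dots> = - 2 * (\<Sum>j<n. rate e j * (LINT t|lebesgue_on {0<..<l}. misfit t * NS x j t))"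
      unfolding sum_distrib_left by (intro sum.cong) (auto simp: misfit_NS mult_ac)
    finally show ?thesis by simp
  qed
  show ?thesis
    using lim unfolding limit eq .
qed

text \<open>The range of \<open>e\<close> in which the uniform bound on the quotients of the
  enrichments holds.\<close>

definition small :: "real \<Rightarrow> bool" where
  "small e \<longleftrightarrow> 0 < e \<and> e \<le> c / 2 \<and> e \<le> (l - c) / 2"

lemma eventually_small': "\<forall>\<^sub>F e in at_right 0. small e"
proof -
  have "0 < min (c / 2) ((l - c) / 2)" using c_interior by simp
  from eventually_at_right_real[OF this] show ?thesis
    by eventually_elim (auto simp: small_def)
qed

lemma right_quotient_NE_small:
  assumes "small e"
  shows "(\<lambda>t. right_quotient (\<lambda>e. NE l c e b t) e) \<in> borel_measurable (lebesgue_on {0<..<l})"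
    and "t \<in> {0<..<l} \<Longrightarrow> \<bar>right_quotient (\<lambda>e. NE l c e b t) e\<bar> \<le> 2 * l / c\<^sup>2 + 2 * l / (l - c)\<^sup>2"
proof -
  have e: "0 < e" "e \<le> c / 2" "e \<le> (l - c) / 2" using assms by (auto simp: small_def)
  have "e < c" using e c_interior by linarith
  moreover have "e < l - c"
    by (rule le_less_trans[OF e(3)]) (use c_interior in simp)
  ultimately show "(\<lambda>t. right_quotient (\<lambda>e. NE l c e b t) e) \<in> borel_measurable (lebesgue_on {0<..<l})"
    using e by (intro right_quotient_NE_measurable c_interior)
  show "\<bar>right_quotient (\<lambda>e. NE l c e b t) e\<bar> \<le> 2 * l / c\<^sup>2 + 2 * l / (l - c)\<^sup>2" if "t \<in> {0<..<l}"
    using that by (intro right_quotient_NE_bound c_interior e) auto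
qed

text \<open>Splitting the misfit into hats and \<open>uhat\<close> gives the limit in the
  coordinates of \<open>dMSE\<close> and \<open>dmE\<close>.\<close>

lemma misfit_enrichment_tendsto:
  "((\<lambda>e. LINT t|lebesgue_on {0<..<l}. misfit t * right_quotient (\<lambda>e. NE l c e b t) e) \<longlongrightarrow> shape_weight b) (at_right 0)"
proof (rule Lim_transform_eventually)
  obtain N where N: "\<And>j t. j < n \<Longrightarrow> t \<in> {0..l} \<Longrightarrow> \<bar>NS x j t\<bar> \<le> N j"
    using NS_bounded by blast
  have NS: "integrable (lebesgue_on {0<..<l}) (NS x i)" if "i < n" for i
    using N[OF that] that by (intro integrable_lebesgue_on_bounded[where S="{}" and C="N i"] NS_measurable) auto
  show "((\<lambda>e. (\<Sum>i<n. u $ i * (LINT t|lebesgue_on {0<..<l}. NS x i t * right_quotient (\<lambda>e. NE l c e b t) e))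
      - (LINT t|lebesgue_on {0<..<l}. uhat t * right_quotient (\<lambda>e. NE l c e b t) e)) \<longlongrightarrow> shape_weight b) (at_right 0)"
    unfolding shape_weight_def
    by (intro tendsto_intros tendsto_LINT_right_quotient_NE c_interior NS integrable_if_L2_on data) auto
  show "\<forall>\<^sub>F e in at_right 0. (\<Sum>i<n. u $ i * (LINT t|lebesgue_on {0<..<l}. NS x i t * right_quotient (\<lambda>e. NE l c e b t) e))
      - (LINT t|lebesgue_on {0<..<l}. uhat t * right_quotient (\<lambda>e. NE l c e b t) e)
      = (LINT t|lebesgue_on {0<..<l}. misfit t * right_quotient (\<lambda>e. NE l c e b t) e)"
    using eventually_small'
  proof eventually_elim
    case (elim e)
    let ?r = "\<lambda>t. right_quotient (\<lambda>e. NE l c e b t) e"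
    have 1: "integrable (lebesgue_on {0<..<l}) (\<lambda>t. NS x i t * ?r t)" if "i < n" for i
      by (rule integrable_mult_bounded[OF NS[OF that] right_quotient_NE_small[OF elim]])
    have 2: "integrable (lebesgue_on {0<..<l}) (\<lambda>t. uhat t * ?r t)"
      by (rule integrable_mult_bounded[OF integrable_if_L2_on[OF data(2)] right_quotient_NE_small[OF elim]])
    have "misfit t * ?r t = (\<Sum>i<n. u $ i * (NS x i t * ?r t)) - uhat t * ?r t" for t
      by (simp add: misfit_def uh_def fem_fun_def left_diff_distrib sum_distrib_right mult.assoc)
    moreover have "has_bochner_integral (lebesgue_on {0<..<l})
        (\<lambda>t. (\<Sum>i<n. u $ i * (NS x i t * ?r t)) - uhat t * ?r t)
        ((\<Sum>i<n. u $ i * (LINT t|lebesgue_on {0<..<l}. NS x i t * ?r t)) - (LINT t|lebesgue_on {0<..<l}. uhat t * ?r t))"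
      by (intro has_bochner_integral_diff has_bochner_integral_linear_combination has_bochner_integral_integrable 1 2) simp
    ultimately show ?case
      by (simp add: has_bochner_integral_iff)
  qed
qed

text \<open>Divided by \<open>2 * e\<close>, the quadratic expansion is the integral of the misfit
  against the variation plus \<open>e / 2\<close> times the squared norm of the variation. The last
  term vanishes because the variation stays bounded.\<close>

lemma objective_quotient_tendsto:
  "((\<lambda>e. (objective l uhat (uh_enriched l x n k e (uS e) (uE e)) - objective l uhat (uh x n u)) / (2 * e))
    \<longlongrightarrow> S0 l l1 l2 x n k u p + S1 l uhat x n k u (vec 2 v0) + S2 l l1 l2 x n k p (vec 2 v0)) (at_right 0)"
proof -
  let ?m = "lebesgue_on {0<..<l}"
  let ?r = "\<lambda>b e t. right_quotient (\<lambda>e. NE l c e b t) e"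
  define Q where "Q = 2 * l / c\<^sup>2 + 2 * l / (l - c)\<^sup>2"
  obtain N where N: "\<And>j t. j < n \<Longrightarrow> t \<in> {0..l} \<Longrightarrow> \<bar>NS x j t\<bar> \<le> N j"
    using NS_bounded by blast
  \<comment> \<open>A bound on \<open>variation e\<close> that is uniform in \<open>t\<close> and
    converges as \<open>e\<close> tends to 0, because the rates and the enrichment coefficients
    do.\<close>
  define V where "V e = (\<Sum>j<n. \<bar>rate e j\<bar> * N j) + (\<Sum>b<2. \<bar>uE e $ b\<bar> * Q)" for e
  obtain y where y: "\<And>j. j < n \<Longrightarrow> ((\<lambda>e. rate e j) \<longlongrightarrow> y j) (at_right 0)"
    using rate_convergent by metis
  have V_tendsto: "(V \<longlongrightarrow> (\<Sum>j<n. \<bar>y j\<bar> * N j) + (\<Sum>b<2. \<bar>v0 b\<bar> * Q)) (at_right 0)"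
    unfolding V_def by (intro tendsto_intros y coefficients_tendsto) auto
  have V: "\<bar>variation e t\<bar> \<le> V e" if "small e" "t \<in> {0<..<l}" for e t
  proof -
    have "\<bar>\<Sum>j<n. rate e j * NS x j t\<bar> \<le> (\<Sum>j<n. \<bar>rate e j\<bar> * N j)"
      by (rule order_trans[OF sum_abs]) (use that in \<open>auto simp: abs_mult intro!: sum_mono mult_left_mono N\<close>)
    moreover have "\<bar>\<Sum>b<2. uE e $ b * ?r b e t\<bar> \<le> (\<Sum>b<2. \<bar>uE e $ b\<bar> * Q)"
      unfolding Q_def
      by (rule order_trans[OF sum_abs], unfold abs_mult, intro sum_mono mult_left_mono right_quotient_NE_small that) auto
    ultimately show ?thesis unfolding variation_def V_def by linarith
  qed
  have meas: "variation e \<in> borel_measurable ?m" if "small e" for e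
    unfolding variation_def using right_quotient_NE_small(1)[OF that]
    by (intro borel_measurable_add borel_measurable_sum borel_measurable_times NS_measurable) auto
  define I1 where "I1 e = (\<Sum>j<n. rate e j * (LINT t|?m. misfit t * NS x j t))
    + (\<Sum>b<2. uE e $ b * (LINT t|?m. misfit t * ?r b e t))" for e
  define I2 where "I2 e = (LINT t|?m. variation e t * variation e t)" for e
  have "(I1 \<longlongrightarrow> 1 / 2 * (\<Sum>i<n. p $ i * residual i) + (\<Sum>b<2. v0 b * shape_weight b)) (at_right 0)"
    unfolding I1_def by (intro tendsto_intros misfit_rate_tendsto coefficients_tendsto misfit_enrichment_tendsto) auto
  moreover have "((\<lambda>e. e / 2 * I2 e) \<longlongrightarrow> 0) (at_right 0)"
  proof (rule Lim_null_comparison)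
    show "\<forall>\<^sub>F e in at_right 0. norm (e / 2 * I2 e) \<le> e / 2 * (l * (V e)\<^sup>2)"
      using eventually_small'
    proof eventually_elim
      case (elim e)
      have "norm (I2 e) \<le> (LINT t|?m. (V e)\<^sup>2)"
        unfolding I2_def
      proof (rule Bochner_Integration.integral_norm_bound_integral)
        have i: "integrable ?m (variation e)"
          using V[OF elim] meas[OF elim] by (intro integrable_lebesgue_on_bounded[where S="{}"]) auto
        show "integrable ?m (\<lambda>t. variation e t * variation e t)"
          by (rule integrable_mult_bounded[OF i meas[OF elim] V[OF elim]])
        show "integrable ?m (\<lambda>t. (V e)\<^sup>2)"
          by (rule integrable_lebesgue_on_bounded[where S="{}" and C="(V e)\<^sup>2"]) auto
        fix t assume "t \<in> space ?m"
        then have "\<bar>variation e t\<bar>\<^sup>2 \<le> (V e)\<^sup>2"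
          using V[OF elim, of t] by (intro power_mono) auto
        then show "norm (variation e t * variation e t) \<le> (V e)\<^sup>2"
          by (simp add: power2_eq_square)
      qed
      also have "\<dots> = l * (V e)\<^sup>2"
        using l_pos by (simp add: measure_restrict_space)
      finally show ?case
        using elim by (simp add: small_def abs_mult mult_left_mono)
    qed
    have "((\<lambda>e. e / 2 * (l * (V e)\<^sup>2)) \<longlongrightarrow> 0 / 2 * (l * ((\<Sum>j<n. \<bar>y j\<bar> * N j) + (\<Sum>b<2. \<bar>v0 b\<bar> * Q))\<^sup>2)) (at_right 0)"
      by (intro tendsto_intros V_tendsto) auto
    then show "((\<lambda>e. e / 2 * (l * (V e)\<^sup>2)) \<longlongrightarrow> 0) (at_right 0)"
      by simp
  qed
  ultimately have lim: "((\<lambda>e. I1 e + e / 2 * I2 e)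
      \<longlongrightarrow> 1 / 2 * (\<Sum>i<n. p $ i * residual i) + (\<Sum>b<2. v0 b * shape_weight b)) (at_right 0)"
    using tendsto_add by fastforce
  have "\<forall>\<^sub>F e in at_right 0. I1 e + e / 2 * I2 e
      = (objective l uhat (uh_enriched l x n k e (uS e) (uE e)) - objective l uhat (uh x n u)) / (2 * e)"
    using eventually_small'
  proof eventually_elim
    case (elim e)
    have e: "0 < e" using elim by (simp add: small_def)
    have i: "integrable ?m (\<lambda>t. misfit t * ?r b e t)" for b
      by (rule integrable_mult_bounded[OF integrable_if_L2_on[OF L2_on_misfit] right_quotient_NE_small[OF elim]])
    have "misfit t * variation e t = (\<Sum>j<n. rate e j * (misfit t * NS x j t)) + (\<Sum>b<2. uE e $ b * (misfit t * ?r b e t))" for t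
      by (simp add: variation_def distrib_left sum_distrib_left mult_ac)
    moreover have "has_bochner_integral ?m
        (\<lambda>t. (\<Sum>j<n. rate e j * (misfit t * NS x j t)) + (\<Sum>b<2. uE e $ b * (misfit t * ?r b e t))) (I1 e)"
      unfolding I1_def
      by (intro has_bochner_integral_add has_bochner_integral_linear_combination integrable_misfit_NS i) simp
    ultimately have "(LINT t|?m. misfit t * variation e t) = I1 e"
      by (simp add: has_bochner_integral_iff)
    moreover have "objective l uhat (uh_enriched l x n k e (uS e) (uE e)) = objective l uhat (\<lambda>t. uh x n u t + e * variation e t)"
      unfolding objective_def using uh_enriched_eq[of e] e
      by (intro Bochner_Integration.integral_cong) auto
    moreover have "\<dots> = objective l uhat (uh x n u) + 2 * e * (LINT t|?m. misfit t * variation e t) + e\<^sup>2 * I2 e"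
      unfolding misfit_def I2_def using L2_on_misfit
      by (intro objective_perturbed[OF _ meas[OF elim] V[OF elim]]) (simp_all add: misfit_def[abs_def])
    ultimately show ?case
      using e by (simp add: field_simps power2_eq_square)
  qed
  with lim show ?thesis
    unfolding topological_derivative_eq by (rule Lim_transform_eventually)
qed

end

text \<open>\<open>right_deriv\<close> is a \<open>Lim\<close> and has an unspecified value where
  the limit does not exist. The differentiability claims therefore accompany the formula: they
  ensure that \<open>dKS\<close>, \<open>dKSE\<close> and, almost everywhere, \<open>dNE\<close> are
  genuine one-sided derivatives.\<close>

theorem theorem4p7:
  fixes l l1 l2 :: real and f uhat :: "real \<Rightarrow> real"
    and x :: "nat \<Rightarrow> real" and n k :: nat
    and u p :: "real vec" and uS uE :: "real \<Rightarrow> real vec"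
  assumes pos: "0 < l" "0 < l1" "0 < l2"
    and data: "L2_on l f" "L2_on l uhat"
    and mesh: "x 0 = 0" "x (Suc n) = l" "\<And>i. i \<le> n \<Longrightarrow> x i < x (Suc i)"
    and node: "1 \<le> k" "k \<le> n"
    and state: "u \<in> carrier_vec n" "KS l l1 l2 x n k 0 *\<^sub>v u = fS l f x n"
    and enriched:
      "\<And>\<epsilon>. 0 < \<epsilon> \<Longrightarrow> \<epsilon> < eps_bar x k \<Longrightarrow> uS \<epsilon> \<in> carrier_vec n"
      "\<And>\<epsilon>. 0 < \<epsilon> \<Longrightarrow> \<epsilon> < eps_bar x k \<Longrightarrow> uE \<epsilon> \<in> carrier_vec 2"
      "\<And>\<epsilon>. 0 < \<epsilon> \<Longrightarrow> \<epsilon> < eps_bar x k \<Longrightarrow>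
         enriched_matrix l l1 l2 x n k \<epsilon> *\<^sub>v (uS \<epsilon> @\<^sub>v uE \<epsilon>) = fS l f x n @\<^sub>v fE l f x k \<epsilon>"
    and adjoint: "p \<in> carrier_vec n"
      "transpose_mat (KS l l1 l2 x n k 0) *\<^sub>v p =
         (- 2) \<cdot>\<^sub>v (mass l n (NS x) n (NS x) *\<^sub>v u - load l uhat n (NS x))"
  shows
    "(\<forall>i<n. \<forall>j<n. right_differentiable (\<lambda>\<epsilon>. KS l l1 l2 x n k \<epsilon> $$ (i, j))) \<and>
     (\<forall>i<n. \<forall>j<2. right_differentiable (\<lambda>\<epsilon>. KSE l l1 l2 x n k \<epsilon> $$ (i, j))) \<and>
     (\<forall>i<2. AE t in lebesgue_on {0<..<l}. right_differentiable (\<lambda>\<epsilon>. NE l (x k) \<epsilon> i t)) \<and>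
     (\<exists>uE0 \<in> carrier_vec 2.
        (\<forall>i<2. ((\<lambda>\<epsilon>. uE \<epsilon> $ i) \<longlongrightarrow> uE0 $ i) (at_right 0)) \<and>
        ((\<lambda>\<epsilon>. (objective l uhat (uh_enriched l x n k \<epsilon> (uS \<epsilon>) (uE \<epsilon>))
                 - objective l uhat (uh x n u)) / (2 * \<epsilon>))
           \<longlongrightarrow> S0 l l1 l2 x n k u p + S1 l uhat x n k u uE0 + S2 l l1 l2 x n k p uE0)
          (at_right 0))"
proof -
  interpret enriched_solution l x n l1 l2 k f uhat u p uS uE
    by unfold_locales (use assms in auto)
  have c: "x k = c" by (simp add: c_def)
  have "AE t in lebesgue_on {0<..<l}. right_differentiable (\<lambda>\<epsilon>. NE l (x k) \<epsilon> i t)" for i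
    by (rule AE_lebesgue_on_finite[where S="{x k}"])
      (use c_interior in \<open>auto simp: c intro: right_differentiable_NE\<close>)
  moreover have "\<exists>uE0 \<in> carrier_vec 2.
        (\<forall>i<2. ((\<lambda>\<epsilon>. uE \<epsilon> $ i) \<longlongrightarrow> uE0 $ i) (at_right 0)) \<and>
        ((\<lambda>\<epsilon>. (objective l uhat (uh_enriched l x n k \<epsilon> (uS \<epsilon>) (uE \<epsilon>))
                 - objective l uhat (uh x n u)) / (2 * \<epsilon>))
           \<longlongrightarrow> S0 l l1 l2 x n k u p + S1 l uhat x n k u uE0 + S2 l l1 l2 x n k p uE0)
          (at_right 0)"
    using coefficients_tendsto(2) objective_quotient_tendsto by (intro bexI[of _ "vec 2 v0"]) auto
  ultimately show ?thesis
    using right_differentiable_KS right_differentiable_KSE by blast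
qed

end
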